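(* Let $d\ge3$ and $h\in\mathbb R$, and suppose that for each integer $L\ge1$ we are given an $h$-admissible family of events $(\mathcal E^b_B,\mathcal E^{vb}_B)_{B\in L\mathbb Z^d}$. For every $\rho>0$ and $\delta>0$ there exist constants $t=t(d,\rho,\delta)\in(0,1)$, $L_0=L_0(d,\rho,\delta)>0$ and $N_0=N_0(d,\rho,\delta)>0$ (not depending on $h$ or on the chosen events) such that for every $N\ge N_0$ there is a family $\mathcal I_N$ of interfaces with the following properties: (a) $|\mathcal I_N|\le e^{\delta tN}$; (b) every $\mathcal I\in\mathcal I_N$ satisfies $L_0\le L_1$ and $|\mathcal I|\le\delta tN$, where $L_1$ is the smallest scale of $\mathcal I$; (c) on the event $A_N(h)$, some $\mathcal I\in\mathcal I_N$ occurs such that its largest scale $L_k$ satisfies $L_k\le\mathrm{diam}(\mathcal C_o(h))$, $\mathcal B(\mathcal I)\subset L_1\mathbb Z^d$, and at least one of the following holds: (c1) $\mathrm{cap}\big(\bigcup_{B\in\mathcal{VB}(\mathcal I)}B\big)\ge N/(4d)$; (c2) $|\mathcal B(\mathcal I)|\,L_1^{\rho}\ge tN$.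
   Context: $\varphi$ is the GFF on $\mathbb Z^d$ (centered Gaussian, covariance the Green function $g(x,y)=\frac1{2d}\sum_{n\ge0}P_x[X_n=y]$ of simple random walk). $\mathcal C_o(h)$ is the cluster of the origin in the induced subgraph $\{\varphi\ge h\}$; diameters are with respect to the graph distance of $\mathbb Z^d$. $\overline S=S\cup\{x\notin S:x\sim y\in S\}$, $\mathrm{cap}(K)=\sum_{x\in K}2dP_x[\widetilde H_K=\infty]$, $\widetilde H_K=\min\{n\ge1:X_n\in K\}$, and $A_N(h)=\{|\mathcal C_o(h)|<\infty\}\cap\{N-1\le\mathrm{cap}(\overline{\mathcal C_o(h)})<N\}$. For an integer $L\ge1$, $L\mathbb Z^d$ is identified with the set of boxes $B_L(z)=z+[0,L)^d$, $z\in L\mathbb Z^d$, with the graph structure where $B_L(z),B_L(w)$ are neighbours iff $\|z-w\|_1=L$. $\mathcal C_o(h,L)$ is the set of boxes of $L\mathbb Z^d$ containing a vertex of $\mathcal C_o(h)$; for a set $\mathcal S$ of boxes, $\partial\mathcal S$ is the set of boxes of $\mathcal S$ having a neighbour in $L\mathbb Z^d\setminus\mathcal S$. A family of events $\mathcal E^b_B,\mathcal E^{vb}_B$, $B\in L\mathbb Z^d$, is $h$-admissible if, with $\mathcal E_B=\mathcal E^b_B\cup\mathcal E^{vb}_B$: (i) $\mathcal E^b_B\cap\mathcal E^{vb}_B=\emptyset$ for every $B$; (ii) if $L\le\mathrm{diam}(\mathcal C_o(h))<\infty$ then $\mathcal E_B$ occurs for every $B\in\partial\mathcal C_o(h,L)$;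 (iii) if neighbouring boxes $B,B'$ both lie in $\mathcal C_o(h,L)$ and $\mathcal E^b_B$ occurs, then $\mathcal E_{B'}$ occurs. An interface is a finite collection $\mathcal I$ of pairwise disjoint boxes, each belonging to $L_i\mathbb Z^d$ for one of finitely many integer scales $1\le L_1<\dots<L_k$; it occurs if $\mathcal E_B$ (for the family of the scale of $B$) occurs for every $B\in\mathcal I$. $\mathcal B(\mathcal I)$ (resp. $\mathcal{VB}(\mathcal I)$) is the set of $B\in\mathcal I$ for which $\mathcal E^b_B$ (resp. $\mathcal E^{vb}_B$) occurs. *)

theory Defs
  imports "HOL-Analysis.Analysis" "HOL-Library.Extended_Nat"
begin

type_synonym 'd pt = "'d \<Rightarrow> int"
type_synonym 'd config = "'d pt \<Rightarrow> real"

definition l1dist :: "('d::finite) pt \<Rightarrow> 'd pt \<Rightarrow> nat" where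
  "l1dist x y = nat (\<Sum>j\<in>UNIV. \<bar>x j - y j\<bar>)"

definition adj :: "('d::finite) pt \<Rightarrow> 'd pt \<Rightarrow> bool" where
  "adj x y \<longleftrightarrow> l1dist x y = 1"

definition origin :: "('d::finite) pt" where
  "origin = (\<lambda>_. 0)"

definition avoid_walks :: "('d::finite) pt set \<Rightarrow> 'd pt \<Rightarrow> nat \<Rightarrow> 'd pt list set" where
  "avoid_walks K x n = {ps. length ps = n \<and>
      (\<forall>i<n. adj ((x # ps) ! i) ((x # ps) ! Suc i)) \<and> set ps \<inter> K = {}}"

text \<open>P_x[H~_K = infinity] = lim_n P_x[H~_K > n] (decreasing limit), with
  P_x[H~_K > n] = #(avoiding n-step paths) / (2d)^n.\<close>
definition escape :: "('d::finite) pt set \<Rightarrow> 'd pt \<Rightarrow> real" where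
  "escape K x = (INF n. real (card (avoid_walks K x n)) / (2 * real CARD('d)) ^ n)"

definition cap :: "('d::finite) pt set \<Rightarrow> real" where
  "cap K = (\<Sum>x\<in>K. 2 * real CARD('d) * escape K x)"

definition outer_closure :: "('d::finite) pt set \<Rightarrow> 'd pt set" where
  "outer_closure S = S \<union> {x. x \<notin> S \<and> (\<exists>y\<in>S. adj x y)}"

definition diam :: "('d::finite) pt set \<Rightarrow> enat" where
  "diam S = (SUP p\<in>S \<times> S. enat (l1dist (fst p) (snd p)))"

definition cluster :: "('d::finite) config \<Rightarrow> real \<Rightarrow> 'd pt set" where
  "cluster \<phi> h = {y. h \<le> \<phi> origin \<and>
      (\<lambda>a b. adj a b \<and> h \<le> \<phi> a \<and> h \<le> \<phi> b)\<^sup>*\<^sup>* origin y}"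

definition A_event :: "real \<Rightarrow> real \<Rightarrow> ('d::finite) config set" where
  "A_event h N = {\<phi>. finite (cluster \<phi> h) \<and>
      N - 1 \<le> cap (outer_closure (cluster \<phi> h)) \<and> cap (outer_closure (cluster \<phi> h)) < N}"

text \<open>Boxes of L Z^d: B_L(z), z in L Z^d, represented by the corner z.\<close>
definition lattice :: "nat \<Rightarrow> ('d::finite) pt set" where
  "lattice L = {z. \<forall>j. int L dvd z j}"

definition box :: "nat \<Rightarrow> ('d::finite) pt \<Rightarrow> 'd pt set" where
  "box L z = {x. \<forall>j. z j \<le> x j \<and> x j < z j + int L}"

definition box_adj :: "nat \<Rightarrow> ('d::finite) pt \<Rightarrow> 'd pt \<Rightarrow> bool" where
  "box_adj L z w \<longleftrightarrow> l1dist z w = L"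

definition coarse_cluster :: "('d::finite) config \<Rightarrow> real \<Rightarrow> nat \<Rightarrow> 'd pt set" where
  "coarse_cluster \<phi> h L = {z \<in> lattice L. box L z \<inter> cluster \<phi> h \<noteq> {}}"

definition box_boundary :: "nat \<Rightarrow> ('d::finite) pt set \<Rightarrow> 'd pt set" where
  "box_boundary L S = {z \<in> S. \<exists>w\<in>lattice L. box_adj L z w \<and> w \<notin> S}"

definition admissible ::
  "real \<Rightarrow> nat \<Rightarrow> (nat \<Rightarrow> ('d::finite) pt \<Rightarrow> 'd config set) \<Rightarrow>
     (nat \<Rightarrow> 'd pt \<Rightarrow> 'd config set) \<Rightarrow> bool" where
  "admissible h L Eb Evb \<longleftrightarrow>
     (\<forall>z\<in>lattice L. Eb L z \<inter> Evb L z = {}) \<and>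
     (\<forall>\<phi>. enat L \<le> diam (cluster \<phi> h) \<and> diam (cluster \<phi> h) < \<infinity> \<longrightarrow>
          (\<forall>z\<in>box_boundary L (coarse_cluster \<phi> h L). \<phi> \<in> Eb L z \<union> Evb L z)) \<and>
     (\<forall>\<phi> z w. z \<in> coarse_cluster \<phi> h L \<and> w \<in> coarse_cluster \<phi> h L \<and> box_adj L z w
          \<and> \<phi> \<in> Eb L z \<longrightarrow> \<phi> \<in> Eb L w \<union> Evb L w)"

definition is_interface :: "(nat \<times> ('d::finite) pt) set \<Rightarrow> bool" where
  "is_interface I \<longleftrightarrow> finite I \<and>
     (\<forall>(L, z)\<in>I. 1 \<le> L \<and> z \<in> lattice L) \<and>
     (\<forall>b\<in>I. \<forall>b'\<in>I. b \<noteq> b' \<longrightarrow> box (fst b) (snd b) \<inter> box (fst b') (snd b') = {})"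

definition min_scale :: "(nat \<times> ('d::finite) pt) set \<Rightarrow> nat" where
  "min_scale I = Min (fst ` I)"

definition max_scale :: "(nat \<times> ('d::finite) pt) set \<Rightarrow> nat" where
  "max_scale I = Max (fst ` I)"

definition occurs ::
  "(nat \<Rightarrow> ('d::finite) pt \<Rightarrow> 'd config set) \<Rightarrow> (nat \<Rightarrow> 'd pt \<Rightarrow> 'd config set) \<Rightarrow>
     (nat \<times> 'd pt) set \<Rightarrow> 'd config \<Rightarrow> bool" where
  "occurs Eb Evb I \<phi> \<longleftrightarrow> (\<forall>(L, z)\<in>I. \<phi> \<in> Eb L z \<union> Evb L z)"

definition bad_boxes ::
  "(nat \<Rightarrow> ('d::finite) pt \<Rightarrow> 'd config set) \<Rightarrow> (nat \<times> 'd pt) set \<Rightarrow> 'd config \<Rightarrow> (nat \<times> 'd pt) set" where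
  "bad_boxes E I \<phi> = {(L, z) \<in> I. \<phi> \<in> E L z}"

end

theory Submission
  imports Defs
begin

text \<open>
  Let \<open>C\<close> be the cluster of the origin. Start at the dyadic scale \<open>2 ^ k\<close> comparable to its diameter,
  where boundedly many boxes meet \<open>C\<close>. At each scale keep the very bad boxes and
  replace every bad box by its \<open>2 ^ d\<close> dyadic children, down to a fixed scale \<open>2 ^ s\<close>. If at
  some scale \<open>L\<close> there are at least \<open>t N L powr (- \<rho>)\<close> bad boxes, the bad boxes of the largest such
  scale form the interface of alternative (c2). Otherwise all very bad boxes together with the
  remaining bad boxes of scale \<open>2 ^ s\<close> separate \<open>C\<close> from infinity: by admissibility, a path
  from infinity that enters a bad box can neither reach \<open>C\<close> nor step into a box of the coarse cluster
  where no event occurs. So their union has capacity at least \<open>(N - 1) / (2 d)\<close>,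
  of which the remaining bad boxes carry a negligible part when \<open>t\<close> is small; this is (c1).
  The number of subdivided boxes decays geometrically in the scale, which bounds
  both the size of an interface and the entropy, apart from the choice of \<open>k\<close>. The latter costs only a
  polynomial in \<open>N\<close>, because a superharmonic function gives decay of the Green function and
  hence a polynomial bound of \<open>|C|\<close> in terms of the capacity.
\<close>

section \<open>Simple random walk and escape probabilities\<close>

definition nbrs :: "('d::finite) pt \<Rightarrow> 'd pt set" where
  "nbrs x = {y. adj x y}"

definition avg :: "('d::finite pt \<Rightarrow> real) \<Rightarrow> 'd pt \<Rightarrow> real" where
  "avg f x = (\<Sum>y\<in>nbrs x. f y) / (2 * real CARD('d))"

lemma l1dist_sum: "int (l1dist x y) = (\<Sum>j\<in>UNIV. \<bar>x j - y j\<bar>)"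
  by (simp add: l1dist_def sum_nonneg)

lemma adj_sym: "adj x y \<longleftrightarrow> adj y x"
  by (simp add: adj_def l1dist_def abs_minus_commute)

lemma adj_upd_iff:
  fixes x y :: "('d::finite) pt"
  shows "adj x y \<longleftrightarrow> (\<exists>j. \<exists>s\<in>{1, -1}. y = x(j := x j + s))"
proof
  assume "adj x y"
  then have s: "(\<Sum>j\<in>UNIV. \<bar>x j - y j\<bar>) = 1"
    using l1dist_sum[of x y] by (simp add: adj_def)
  then obtain j where j: "x j \<noteq> y j"
    by (metis (mono_tags, lifting) abs_eq_0 diff_self sum.neutral zero_neq_one)
  have eq: "(\<Sum>l\<in>UNIV. \<bar>x l - y l\<bar>) = \<bar>x j - y j\<bar> + (\<Sum>l\<in>UNIV-{j}. \<bar>x l - y l\<bar>)"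
    by (simp add: sum.remove)
  have nn: "(\<Sum>l\<in>UNIV-{j}. \<bar>x l - y l\<bar>) \<ge> 0"
    by (simp add: sum_nonneg)
  have j1: "\<bar>x j - y j\<bar> = 1" and z: "(\<Sum>l\<in>UNIV-{j}. \<bar>x l - y l\<bar>) = 0"
    using s eq nn j by linarith+
  have "\<forall>l\<in>UNIV-{j}. \<bar>x l - y l\<bar> = 0"
    using z by (subst (asm) sum_nonneg_eq_0_iff) auto
  then have "y = x(j := x j + (y j - x j))"
    by auto
  moreover have "y j - x j \<in> {1, -1}"
    using j1 by auto
  ultimately show "\<exists>j. \<exists>s\<in>{1, -1}. y = x(j := x j + s)"
    by blast
next
  assume "\<exists>j. \<exists>s\<in>{1, -1}. y = x(j := x j + s)"
  then obtain j s where js: "s \<in> {1, -1}" "y = x(j := x j + s)"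
    by blast
  have "(\<Sum>l\<in>UNIV. \<bar>x l - y l\<bar>) = \<bar>x j - y j\<bar> + (\<Sum>l\<in>UNIV-{j}. \<bar>x l - y l\<bar>)"
    by (simp add: sum.remove)
  also have "\<dots> = 1"
    using js by auto
  finally show "adj x y"
    by (simp add: adj_def l1dist_def)
qed

lemma nbrs_eq: "nbrs x = (\<lambda>(j, s). x(j := x j + s)) ` (UNIV \<times> {1, -1})"
  by (auto simp: nbrs_def adj_upd_iff image_iff)

lemma inj_on_nbrs:
  "inj_on (\<lambda>(j, s). x(j := x j + s)) (UNIV \<times> {1, -1 :: int})"
proof (rule inj_onI, clarify)
  fix j s j' s' assume s: "s \<in> {1, -1::int}" "s' \<in> {1, -1::int}"
    and eq: "x(j := x j + s) = x(j' := x j' + s')"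
  show "j = j' \<and> s = s'"
    using fun_cong[OF eq, of j] fun_cong[OF eq, of j'] s
    by (auto split: if_splits)
qed

lemma finite_nbrs [simp]: "finite (nbrs x)"
  unfolding nbrs_eq by simp

lemma card_nbrs: "card (nbrs (x :: ('d::finite) pt)) = 2 * CARD('d)"
  unfolding nbrs_eq by (subst card_image[OF inj_on_nbrs]) (simp add: card_cartesian_product)

lemma sum_nbrs:
  fixes f :: "('d::finite) pt \<Rightarrow> real"
  shows "(\<Sum>y\<in>nbrs x. f y) = (\<Sum>j\<in>UNIV. f (x(j := x j + 1)) + f (x(j := x j - 1)))"
proof -
  have "(\<Sum>y\<in>nbrs x. f y) = (\<Sum>p\<in>UNIV \<times> {1, -1}. f (case p of (j, s) \<Rightarrow> x(j := x j + s)))"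
    unfolding nbrs_eq by (subst sum.reindex[OF inj_on_nbrs]) simp
  also have "\<dots> = (\<Sum>j\<in>UNIV. \<Sum>s\<in>{1, -1}. f (x(j := x j + s)))"
    unfolding sum.cartesian_product by (simp add: case_prod_unfold)
  finally show ?thesis
    by simp
qed

lemma avg_mono: "(\<And>y. adj x y \<Longrightarrow> f y \<le> g y) \<Longrightarrow> avg f x \<le> avg g x"
  unfolding avg_def by (intro divide_right_mono sum_mono) (auto simp: nbrs_def)

lemma avg_cong: "(\<And>y. adj x y \<Longrightarrow> f y = g y) \<Longrightarrow> avg f x = avg g x"
  unfolding avg_def by (auto simp: nbrs_def)

lemma avg_const [simp]: "avg (\<lambda>_. c) x = c"
  by (simp add: avg_def card_nbrs)

lemma avg_diff: "avg (\<lambda>y. f y - g y) x = avg f x - avg g x"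
  by (simp add: avg_def sum_subtractf diff_divide_distrib)

lemma avg_sum: "avg (\<lambda>y. \<Sum>i\<in>I. f i y) x = (\<Sum>i\<in>I. avg (f i) x)"
  unfolding avg_def sum_divide_distrib[symmetric] by (subst sum.swap) (rule refl)

lemma avg_cmult: "avg (\<lambda>y. c * f y) x = c * avg f x"
  by (simp add: avg_def sum_distrib_left)

lemma avg_nonneg: "(\<And>y. adj x y \<Longrightarrow> f y \<ge> 0) \<Longrightarrow> avg f x \<ge> 0"
  using avg_mono[of x "\<lambda>_. 0" f] by simp

lemma tendsto_avg:
  assumes "\<And>y. adj x y \<Longrightarrow> ((\<lambda>n. f n y) \<longlongrightarrow> g y) F"
  shows "((\<lambda>n. avg (f n) x) \<longlongrightarrow> avg g x) F"
  unfolding avg_def using assms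
  by (intro tendsto_divide tendsto_sum tendsto_const) (auto simp: nbrs_def)

lemma avg_reindex:
  fixes x x' :: "('d::finite) pt"
  assumes "bij_betw g (nbrs x) (nbrs x')"
  shows "avg (\<lambda>y. f (g y)) x = avg f x'"
  unfolding avg_def by (simp add: sum.reindex_bij_betw[OF assms])

text \<open>This is P_x[H~_K > n]. The starting point is never tested, so the same formula serves
  points of \<open>K\<close> as well, and \<open>surv_Suc\<close> puts the indicator on the next
  position.\<close>

definition surv :: "('d::finite) pt set \<Rightarrow> nat \<Rightarrow> 'd pt \<Rightarrow> real" where
  "surv K n x = real (card (avoid_walks K x n)) / (2 * real CARD('d)) ^ n"

lemma avoid_walks_Suc:
  "avoid_walks K x (Suc n) = (\<Union>y\<in>nbrs x - K. (#) y ` avoid_walks K y n)"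
proof (rule set_eqI)
  fix ps
  show "ps \<in> avoid_walks K x (Suc n) \<longleftrightarrow> ps \<in> (\<Union>y\<in>nbrs x - K. (#) y ` avoid_walks K y n)"
  proof (cases ps)
    case Nil
    then show ?thesis
      by (auto simp: avoid_walks_def)
  next
    case (Cons y qs)
    have "(\<forall>i<Suc n. adj ((x # y # qs) ! i) ((x # y # qs) ! Suc i)) \<longleftrightarrow>
        adj x y \<and> (\<forall>i<n. adj ((y # qs) ! i) ((y # qs) ! Suc i))"
      by (subst All_less_Suc2) simp
    then show ?thesis
      using Cons by (auto simp: avoid_walks_def nbrs_def)
  qed
qed

lemma avoid_walks_0: "avoid_walks K x 0 = {[]}"
  by (auto simp: avoid_walks_def)

lemma finite_avoid_walks: "finite (avoid_walks K x n)"
  by (induction n arbitrary: x) (auto simp: avoid_walks_0 avoid_walks_Suc)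

lemma surv_0 [simp]: "surv K 0 x = 1"
  by (simp add: surv_def avoid_walks_0)

lemma surv_Suc: "surv K (Suc n) x = avg (\<lambda>y. of_bool (y \<notin> K) * surv K n y) x"
  for x :: "('d::finite) pt"
proof -
  let ?m = "2 * real CARD('d)"
  have "card (avoid_walks K x (Suc n)) = (\<Sum>y\<in>nbrs x - K. card ((#) y ` avoid_walks K y n))"
    unfolding avoid_walks_Suc by (rule card_UN_disjoint) (auto simp: finite_avoid_walks)
  also have "\<dots> = (\<Sum>y\<in>nbrs x - K. card (avoid_walks K y n))"
    by (simp add: card_image)
  finally have "surv K (Suc n) x = (\<Sum>y\<in>nbrs x - K. surv K n y) / ?m"
    by (simp add: surv_def sum_divide_distrib mult_ac)
  also have "(\<Sum>y\<in>nbrs x - K. surv K n y) = (\<Sum>y\<in>nbrs x. of_bool (y \<notin> K) * surv K n y)"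
    by (rule sum.mono_neutral_cong_left) auto
  finally show ?thesis
    by (simp add: avg_def)
qed

lemma surv_nonneg: "surv K n x \<ge> 0"
  by (simp add: surv_def)

lemma surv_decseq: "decseq (\<lambda>n. surv K n x)"
proof (rule decseq_SucI)
  show "surv K (Suc n) x \<le> surv K n x" for n
  proof (induction n arbitrary: x)
    case 0
    have "surv K (Suc 0) x \<le> avg (\<lambda>_. 1) x"
      unfolding surv_Suc by (rule avg_mono) auto
    then show ?case
      by simp
  next
    case (Suc n)
    show ?case
      by (subst (1 2) surv_Suc) (intro avg_mono mult_left_mono Suc.IH, auto)
  qed
qed

lemma surv_le_1: "surv K n x \<le> 1"
  using decseqD[OF surv_decseq, of 0 n K x] by simp

lemma escape_eq: "escape K x = (INF n. surv K n x)"
  by (simp add: escape_def surv_def)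

lemma surv_tendsto: "(\<lambda>n. surv K n x) \<longlonglongrightarrow> escape K x"
  unfolding escape_eq
  by (rule LIMSEQ_decseq_INF) (auto intro!: bdd_belowI[of _ 0] surv_nonneg surv_decseq)

lemma escape_nonneg: "escape K x \<ge> 0"
  by (rule LIMSEQ_le_const[OF surv_tendsto]) (auto simp: surv_nonneg)

lemma escape_le_1: "escape K x \<le> 1"
  by (rule LIMSEQ_le_const2[OF surv_tendsto]) (auto simp: surv_le_1)

lemma escape_step: "escape K x = avg (\<lambda>y. of_bool (y \<notin> K) * escape K y) x"
proof (rule LIMSEQ_unique)
  show "(\<lambda>n. surv K (Suc n) x) \<longlonglongrightarrow> escape K x"
    using surv_tendsto by (rule LIMSEQ_Suc)
  show "(\<lambda>n. surv K (Suc n) x) \<longlonglongrightarrow> avg (\<lambda>y. of_bool (y \<notin> K) * escape K y) x"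
    unfolding surv_Suc by (intro tendsto_avg tendsto_mult tendsto_const surv_tendsto)
qed

lemma surv_antimono:
  assumes "A \<subseteq> B"
  shows "surv B n x \<le> surv A n x"
proof -
  have "avoid_walks B x n \<subseteq> avoid_walks A x n"
    using assms by (auto simp: avoid_walks_def)
  then show ?thesis
    unfolding surv_def by (intro divide_right_mono) (auto intro: card_mono finite_avoid_walks)
qed

lemma escape_antimono: "A \<subseteq> B \<Longrightarrow> escape B x \<le> escape A x"
  by (rule LIMSEQ_le[OF surv_tendsto surv_tendsto]) (auto intro: surv_antimono)

lemma cap_le_card: "cap K \<le> 2 * real CARD('d) * real (card K)" for K :: "('d::finite) pt set"
proof -
  have "cap K \<le> (\<Sum>x\<in>K. 2 * real CARD('d) * 1)"
    unfolding cap_def by (intro sum_mono mult_left_mono escape_le_1) auto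
  then show ?thesis
    by (simp add: mult_ac)
qed

text \<open>Enlarging the set lowers every escape probability, so passing from the union to
  \<open>A\<close> or to \<open>B\<close> alone can only increase the corresponding partial
  sums.\<close>

lemma cap_Un_le:
  assumes "finite A" "finite B"
  shows "cap (A \<union> B) \<le> cap A + cap B"
proof -
  let ?f = "\<lambda>x. 2 * real CARD('a) * escape (A \<union> B) x"
  have nn: "?f x \<ge> 0" for x
    by (simp add: escape_nonneg)
  have "cap (A \<union> B) \<le> sum ?f A + sum ?f B"
    unfolding cap_def using sum.union_inter[OF assms, of ?f] sum_nonneg[of "A \<inter> B" ?f] nn by simp
  also have "sum ?f A \<le> cap A"
    unfolding cap_def by (intro sum_mono mult_left_mono escape_antimono) auto
  also have "sum ?f B \<le> cap B"
    unfolding cap_def by (intro sum_mono mult_left_mono escape_antimono) auto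
  finally show ?thesis
    by simp
qed

section \<open>Transition probabilities of the walk and their symmetries\<close>

primrec heat :: "nat \<Rightarrow> ('d::finite) pt \<Rightarrow> 'd pt \<Rightarrow> real" where
  "heat 0 = (\<lambda>x y. of_bool (x = y))"
| "heat (Suc n) = (\<lambda>x y. avg (\<lambda>z. heat n z y) x)"

lemma heat_nonneg: "heat n x y \<ge> 0"
  by (induction n arbitrary: x) (auto intro: avg_nonneg)

lemma adj_shift: "adj (\<lambda>j. x j + v j) (\<lambda>j. y j + v j) \<longleftrightarrow> adj x y"
  by (simp add: adj_def l1dist_def)

lemma adj_uminus: "adj (\<lambda>j. - x j) (\<lambda>j. - y j) \<longleftrightarrow> adj x y"
  by (simp add: adj_def l1dist_def abs_minus_commute)

lemma heat_shift: "heat n (\<lambda>j. x j + v j) (\<lambda>j. y j + v j) = heat n x y"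
proof (induction n arbitrary: x)
  case 0
  show ?case
    by (simp add: fun_eq_iff)
next
  case (Suc n)
  have bij: "bij_betw (\<lambda>z j. z j + v j) (nbrs x) (nbrs (\<lambda>j. x j + v j))"
    by (rule bij_betw_byWitness[where f' = "\<lambda>z j. z j - v j"])
      (use adj_shift[of x v "\<lambda>j. _ j - v j"] in \<open>auto simp: nbrs_def adj_shift\<close>)
  show ?case
    using avg_reindex[OF bij, of "\<lambda>z. heat n z (\<lambda>j. y j + v j)"] by (simp add: Suc.IH)
qed

lemma heat_uminus: "heat n (\<lambda>j. - x j) (\<lambda>j. - y j) = heat n x y"
proof (induction n arbitrary: x)
  case 0
  show ?case
    by (simp add: fun_eq_iff)
next
  case (Suc n)
  have bij: "bij_betw (\<lambda>z j. - z j) (nbrs x) (nbrs (\<lambda>j. - x j))"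
    by (rule bij_betw_byWitness[where f' = "\<lambda>z j. - z j"])
      (use adj_uminus[of x "\<lambda>j. - _ j"] in \<open>auto simp: nbrs_def adj_uminus\<close>)
  show ?case
    using avg_reindex[OF bij, of "\<lambda>z. heat n z (\<lambda>j. - y j)"] by (simp add: Suc.IH)
qed

text \<open>The point reflection z -> x + y - z preserves the walk and exchanges \<open>x\<close>
  and \<open>y\<close>.\<close>

lemma heat_sym: "heat n x y = heat n y x"
  using heat_shift[of n "\<lambda>j. - y j" "\<lambda>j. x j + y j" "\<lambda>j. - x j"] heat_uminus[of n y x] by simp

lemma heat_translate: "heat n x y = heat n (\<lambda>j. x j - y j) origin"
  using heat_shift[of n "\<lambda>j. x j - y j" y origin] by (simp add: origin_def)

section \<open>Green function and capacity\<close>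

text \<open>The second Taylor coefficient of the left side at 0 is 5/32; raising it to 9/50 absorbs
  all higher terms on this range. Taking fourth powers reduces the claim to a polynomial
  inequality.\<close>

lemma powr_quarter_le:
  fixes u :: real
  assumes "\<bar>u\<bar> \<le> 1/10"
  shows "(1 + u) powr (-1/4) \<le> 1 - u/4 + 9/50 * u\<^sup>2"
proof -
  define q where "q = 1 - u/4 + 9/50 * u\<^sup>2"
  have q0: "q > 0"
    unfolding q_def using assms zero_le_power2[of u] by linarith
  have u0: "1 + u > 0"
    using assms by linarith
  have pow: "\<bar>u ^ n\<bar> \<le> 1 / 10 ^ n" for n
    unfolding power_abs using power_mono[OF assms, of n] by (simp add: power_one_over)
  \<comment> \<open>This polynomial is the quotient of (1 + u) (100 q)^4 - 100^4 by u^2. Its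
    constant term outweighs the other terms together when |u| is at most 1/10.\<close>
  have "9500000 + 49250000 * u ^ 1 - 26919375 * u ^ 2 + 22485625 * u ^ 3 - 7297200 * u ^ 4 + 2964600 * u ^ 5 - 478224 * u ^ 6 + 104976 * u ^ 7 \<ge> 0"
    using pow[of 1] pow[of 2] pow[of 3] pow[of 4] pow[of 5] pow[of 6] pow[of 7]
    unfolding abs_le_iff by simp
  moreover have "(1 + u) * (100 - 25 * u + 18 * u\<^sup>2) ^ 4 - 100 ^ 4 = u\<^sup>2 * (9500000 + 49250000 * u ^ 1 - 26919375 * u ^ 2 + 22485625 * u ^ 3 - 7297200 * u ^ 4 + 2964600 * u ^ 5 - 478224 * u ^ 6 + 104976 * u ^ 7)"
    by algebra
  moreover have "100 - 25 * u + 18 * u\<^sup>2 = 100 * q"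
    by (simp add: q_def)
  ultimately have "(1 + u) * (100 * q) ^ 4 - 100 ^ 4 \<ge> 0"
    by (simp only: mult_nonneg_nonneg zero_le_power2)
  then have "(1 + u) * q ^ 4 - 1 \<ge> 0"
    by (simp add: power_mult_distrib)
  then have "1 / (1 + u) \<le> q ^ 4"
    using u0 by (simp add: field_simps)
  then have "(1 / (1 + u)) powr (1/4) \<le> (q ^ 4) powr (1/4)"
    using u0 by (intro powr_mono2) auto
  also have "(q ^ 4) powr (1/4) = (q powr 4) powr (1/4)"
    using q0 by simp
  also have "\<dots> = q"
    unfolding powr_powr using q0 by simp
  finally show ?thesis
    using u0 by (simp add: q_def powr_minus_divide powr_divide)
qed

text \<open>
  The exponent \<open>1/4\<close> lies strictly between \<open>0\<close> and \<open>1/2 = (3 - 2)/2\<close>, so in dimension at least three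
  the second-order terms of the Laplacian have the right sign with room to spare; the shift
  \<open>1000\<close> makes the lattice corrections negligible.
\<close>

definition pot :: "('d::finite) pt \<Rightarrow> real" where
  "pot x = (1000 + (\<Sum>j\<in>UNIV. (real_of_int (x j))\<^sup>2)) powr (-1/4)"

text \<open>The excess of \<open>pot\<close> at the origin over its average on the neighbours, all
  of which have squared norm 1. It normalises \<open>pot\<close> into a bound for the Green
  function.\<close>

definition pot_drop :: real where
  "pot_drop = 1000 powr (-1/4) - 1001 powr (-1/4)"

lemma pot_drop_pos: "pot_drop > 0"
  unfolding pot_drop_def by (simp add: powr_less_mono2_neg)

lemma pot_nonneg: "pot x \<ge> 0"
  by (simp add: pot_def)

text \<open>Moving one coordinate by \<open>s\<close> multiplies \<open>r\<close> by 1 + u, and the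
  shift by 1000 keeps u small enough for \<open>powr_quarter_le\<close>.\<close>

lemma pot_step_le:
  fixes x :: "('d::finite) pt" and s :: int and j :: 'd
  defines "r \<equiv> 1000 + (\<Sum>j\<in>UNIV. (real_of_int (x j))\<^sup>2)"
  assumes s: "s \<in> {1, -1}"
  defines "u \<equiv> (1 + 2 * s * x j) / r"
  shows "pot (x(j := x j + s)) \<le> pot x * (1 - u/4 + 9/50 * u\<^sup>2)"
proof -
  have r1000: "r \<ge> 1000"
    by (simp add: r_def sum_nonneg)
  have s2: "real_of_int s * real_of_int s = 1"
    using s by auto
  have split: "(\<Sum>l\<in>UNIV. (real_of_int (y l))\<^sup>2) =
      (real_of_int (y j))\<^sup>2 + (\<Sum>l\<in>UNIV-{j}. (real_of_int (y l))\<^sup>2)" for y :: "'d pt"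
    by (simp add: sum.remove)
  have new: "1000 + (\<Sum>l\<in>UNIV. (real_of_int ((x(j := x j + s)) l))\<^sup>2) = r * (1 + u)"
  proof -
    have "1000 + (\<Sum>l\<in>UNIV. (real_of_int ((x(j := x j + s)) l))\<^sup>2) = r + (1 + 2 * s * x j)"
      unfolding r_def split[of x] split[of "x(j := x j + s)"]
      using s2 by (simp add: power2_eq_square algebra_simps)
    also have "\<dots> = r * (1 + u)"
      using r1000 by (simp add: u_def field_simps)
    finally show ?thesis .
  qed
  have "(real_of_int (x j))\<^sup>2 \<le> r"
    using split[of x] unfolding r_def by (simp add: sum_nonneg add_increasing2)
  then have xj: "\<bar>real_of_int (x j)\<bar> \<le> sqrt r"
    using real_le_rsqrt[of "\<bar>real_of_int (x j)\<bar>" r] by simp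
  \<comment> \<open>Since 31^2 = 961 is below 1000; this is large enough for 1 + 2 sqrt r to be at
    most r / 10.\<close>
  have sr: "sqrt r \<ge> 31"
    using r1000 by (intro real_le_rsqrt) simp
  have sq: "r = sqrt r * sqrt r"
    using r1000 by simp
  have "\<bar>1 + 2 * s * real_of_int (x j)\<bar> \<le> 1 + 2 * sqrt r"
    using xj s by auto
  also have "\<dots> \<le> 1/10 * r"
    using mult_right_mono[OF sr, of "sqrt r"] sr sq by linarith
  finally have u: "\<bar>u\<bar> \<le> 1/10"
    using r1000 by (simp add: u_def field_simps)
  have "pot (x(j := x j + s)) = (r * (1 + u)) powr (-1/4)"
    unfolding pot_def new ..
  also have "\<dots> = pot x * (1 + u) powr (-1/4)"
    using r1000 u by (subst powr_mult) (auto simp: pot_def r_def)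
  also have "\<dots> \<le> pot x * (1 - u/4 + 9/50 * u\<^sup>2)"
    by (intro mult_left_mono powr_quarter_le u pot_nonneg)
  finally show ?thesis .
qed

text \<open>Adding the two steps in a direction cancels the terms linear in the coordinate. In total
  the first-order part gains d / (2 r), while the second-order part costs about 8 * 9/50 / r = 36/25
  / r. The constant 9/50 was chosen so that 36/25 < 3/2, which makes d = 3 suffice.\<close>

lemma pot_superharmonic:
  fixes x :: "('d::finite) pt"
  assumes "CARD('d) \<ge> 3"
  shows "avg pot x \<le> pot x"
proof -
  define r where "r = 1000 + (\<Sum>j\<in>UNIV. (real_of_int (x j))\<^sup>2)"
  let ?d = "real CARD('d)"
  have r1000: "r \<ge> 1000"
    by (simp add: r_def sum_nonneg)
  have "(\<Sum>y\<in>nbrs x. pot y) \<le> (\<Sum>j\<in>UNIV. pot x * (2 - 1/(2*r) + 9/50 * (2 + 8 * (x j)\<^sup>2) / r\<^sup>2))"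
    unfolding sum_nbrs
  proof (rule sum_mono)
    fix j
    have "pot (x(j := x j + 1)) + pot (x(j := x j - 1)) \<le>
      pot x * (1 - (1 + 2 * x j)/r/4 + 9/50 * ((1 + 2 * x j)/r)\<^sup>2) +
      pot x * (1 - (1 - 2 * x j)/r/4 + 9/50 * ((1 - 2 * x j)/r)\<^sup>2)"
      using pot_step_le[of 1 x j] pot_step_le[of "-1" x j] unfolding r_def
      by (intro add_mono) auto
    also have "\<dots> = pot x * (2 - 1/(2*r) + 9/50 * (2 + 8 * (x j)\<^sup>2) / r\<^sup>2)"
      using r1000 by (simp add: field_simps power2_eq_square)
    finally show "pot (x(j := x j + 1)) + pot (x(j := x j - 1)) \<le> \<dots>" .
  qed
  also have "\<dots> = pot x * (\<Sum>j\<in>UNIV. 2 - 1/(2*r) + 9/50 * (2 + 8 * (real_of_int (x j))\<^sup>2) / r\<^sup>2)"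
    by (simp add: sum_distrib_left)
  also have "(\<Sum>j\<in>UNIV. 2 - 1/(2*r) + 9/50 * (2 + 8 * (real_of_int (x j))\<^sup>2) / r\<^sup>2) =
      (2 - 1/(2*r)) * ?d + 9/50 * (2 * ?d + 8 * (r - 1000)) / r\<^sup>2"
    by (simp add: r_def sum.distrib sum_subtractf flip: sum_divide_distrib sum_distrib_left)
  also have "\<dots> \<le> 2 * ?d"
  proof -
    have "(?d/2 - 36/25) * r \<ge> (?d/2 - 36/25) * 1000"
      using assms r1000 by (intro mult_left_mono) auto
    then have "9/50 * (2 * ?d + 8 * (r - 1000)) \<le> ?d / 2 * r"
      using assms by (simp add: algebra_simps)
    then have "9/50 * (2 * ?d + 8 * (r - 1000)) / r\<^sup>2 \<le> ?d / 2 * r / r\<^sup>2"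
      by (rule divide_right_mono) simp
    also have "\<dots> = 1/(2*r) * ?d"
      using r1000 by (simp add: power2_eq_square field_simps)
    finally show ?thesis
      by (simp add: algebra_simps)
  qed
  finally have "(\<Sum>y\<in>nbrs x. pot y) \<le> pot x * (2 * ?d)"
    using pot_nonneg[of x] by (simp add: mult_left_mono)
  then show ?thesis
    by (simp add: avg_def field_simps)
qed

lemma pot_origin_drop: "avg pot (origin :: ('d::finite) pt) + pot_drop = pot (origin :: 'd pt)"
proof -
  have "pot y = 1001 powr (-1/4)" if adj: "adj (origin :: 'd pt) y" for y
  proof -
    obtain j s where js: "s \<in> {1, -1}" "y = origin(j := origin j + s)"
      using adj unfolding adj_upd_iff by blast
    have "(\<Sum>l\<in>UNIV. (real_of_int (y l))\<^sup>2) = (\<Sum>l\<in>UNIV. if l = j then 1 else 0)"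
      using js by (intro sum.cong) (auto simp: origin_def)
    then show ?thesis
      by (simp add: pot_def)
  qed
  then have "avg pot (origin :: 'd pt) = 1001 powr (-1/4)"
    by (subst avg_cong[where g = "\<lambda>_. 1001 powr (-1/4)"]) auto
  then show ?thesis
    by (simp add: pot_drop_def pot_def origin_def)
qed

text \<open>A discrete maximum principle, by induction on the first step: superharmonicity preserves
  the bound, and at the origin the drop of \<open>pot\<close> pays for the visit counted at time
  0.\<close>

lemma heat_sum_le_pot:
  fixes x :: "('d::finite) pt"
  assumes "CARD('d) \<ge> 3"
  shows "pot_drop * (\<Sum>n<M. heat n x origin) \<le> pot x"
proof (induction M arbitrary: x)
  case 0
  show ?case
    by (simp add: pot_nonneg)
next
  case (Suc M)
  have "pot_drop * (\<Sum>n<Suc M. heat n x origin) =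
      pot_drop * of_bool (x = origin) + avg (\<lambda>z. pot_drop * (\<Sum>n<M. heat n z origin)) x"
    unfolding sum.lessThan_Suc_shift avg_cmult avg_sum by (simp add: distrib_left)
  also have "\<dots> \<le> pot_drop * of_bool (x = origin) + avg pot x"
    by (intro add_left_mono avg_mono Suc.IH)
  also have "\<dots> \<le> pot x"
    using pot_origin_drop[where 'd = 'd] pot_superharmonic[OF assms, of x] by auto
  finally show ?case .
qed

text \<open>The factor 1/(2d) of the usual normalisation is left out; accordingly it is paired below
  with \<open>escape\<close>, without the factor 2d that occurs in \<open>cap\<close>.\<close>

definition green :: "('d::finite) pt \<Rightarrow> 'd pt \<Rightarrow> real" where
  "green x y = (\<Sum>n. heat n x y)"

lemma heat_partial_sum_le:
  fixes x y :: "('d::finite) pt"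
  assumes "CARD('d) \<ge> 3"
  shows "(\<Sum>n<M. heat n x y) \<le> pot (\<lambda>j. x j - y j) / pot_drop"
  using heat_sum_le_pot[OF assms, where M = M and x = "\<lambda>j. x j - y j"] pot_drop_pos
  by (simp add: heat_translate[of _ x y] field_simps)

lemma heat_summable:
  fixes x y :: "('d::finite) pt"
  assumes "CARD('d) \<ge> 3"
  shows "summable (\<lambda>n. heat n x y)"
  by (rule summableI_nonneg_bounded[OF heat_nonneg heat_partial_sum_le[OF assms]])

lemma green_le_pot:
  fixes x y :: "('d::finite) pt"
  assumes "CARD('d) \<ge> 3"
  shows "green x y \<le> pot (\<lambda>j. x j - y j) / pot_drop"
  unfolding green_def
  by (rule suminf_le_const[OF heat_summable[OF assms] heat_partial_sum_le[OF assms]])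

lemma green_sym: "green x y = green y x"
  unfolding green_def by (rule suminf_cong, rule heat_sym)

text \<open>Both sides are the probability that the walk from \<open>x\<close> visits \<open>K\<close> up to time \<open>M\<close>, decomposed
  on the left according to the time and place of the last visit.\<close>

lemma last_exit_finite:
  assumes "finite K"
  shows "(\<Sum>y\<in>K. \<Sum>n\<le>M. heat n x y * surv K (M - n) y) = 1 - of_bool (x \<notin> K) * surv K M x"
proof (induction M arbitrary: x)
  case 0
  show ?case
    using assms by simp
next
  case (Suc M)
  have "(\<Sum>y\<in>K. \<Sum>n\<le>Suc M. heat n x y * surv K (Suc M - n) y) =
      (\<Sum>y\<in>K. of_bool (x = y) * surv K (Suc M) y) +
      (\<Sum>y\<in>K. \<Sum>n\<le>M. avg (\<lambda>z. heat n z y) x * surv K (M - n) y)"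
    unfolding sum.atMost_Suc_shift by (simp add: sum.distrib)
  also have "(\<Sum>y\<in>K. of_bool (x = y) * surv K (Suc M) y) = of_bool (x \<in> K) * surv K (Suc M) x"
    using assms by simp
  also have "(\<Sum>y\<in>K. \<Sum>n\<le>M. avg (\<lambda>z. heat n z y) x * surv K (M - n) y) =
      avg (\<lambda>z. \<Sum>y\<in>K. \<Sum>n\<le>M. heat n z y * surv K (M - n) y) x"
    unfolding avg_sum by (subst (1 2) mult.commute) (simp add: avg_cmult)
  also have "\<dots> = 1 - surv K (Suc M) x"
    unfolding Suc.IH avg_diff surv_Suc by simp
  finally show ?case
    by auto
qed

text \<open>The time horizon in \<open>last_exit_finite\<close> is sent to infinity. Extending the
  summands by 0 beyond \<open>M\<close> turns the inner sums into series dominated by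
  \<open>heat n x y\<close>, so Tannery's theorem applies.\<close>

lemma last_exit:
  fixes K :: "('d::finite) pt set"
  assumes "CARD('d) \<ge> 3" and "finite K"
  shows "(\<Sum>y\<in>K. green x y * escape K y) = 1 - of_bool (x \<notin> K) * escape K x"
proof (rule LIMSEQ_unique)
  show "(\<lambda>M. 1 - of_bool (x \<notin> K) * surv K M x) \<longlonglongrightarrow> 1 - of_bool (x \<notin> K) * escape K x"
    by (intro tendsto_intros surv_tendsto)
  have "(\<lambda>M. \<Sum>n\<le>M. heat n x y * surv K (M - n) y) \<longlonglongrightarrow> green x y * escape K y" for y
  proof -
    define F where "F M n = (if n \<le> M then heat n x y * surv K (M - n) y else 0)" for M n
    have lim: "(\<lambda>M. F M n) \<longlonglongrightarrow> heat n x y * escape K y" for n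
    proof -
      have "(\<lambda>M. heat n x y * surv K (M - n) y) \<longlonglongrightarrow> heat n x y * escape K y"
        by (intro tendsto_mult tendsto_const filterlim_compose[OF surv_tendsto])
          (rule filterlim_minus_const_nat_at_top)
      moreover have "eventually (\<lambda>M. heat n x y * surv K (M - n) y = F M n) sequentially"
        using eventually_ge_at_top[of n] by eventually_elim (simp add: F_def)
      ultimately show ?thesis
        by (rule Lim_transform_eventually)
    qed
    have "(\<lambda>M. \<Sum>n. F M n) \<longlonglongrightarrow> (\<Sum>n. heat n x y * escape K y)"
    proof (rule tannerys_theorem[THEN conjunct2, THEN conjunct2])
      show "\<forall>\<^sub>F (n, M) in at_top \<times>\<^sub>F sequentially. norm (F M n) \<le> heat n x y"
        by (rule always_eventually)
          (auto simp: F_def heat_nonneg surv_nonneg surv_le_1 abs_mult mult_left_le)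
    qed (simp_all add: lim heat_summable[OF assms(1)])
    moreover have "(\<Sum>n. F M n) = (\<Sum>n\<le>M. heat n x y * surv K (M - n) y)" for M
    proof -
      have "(\<Sum>n. F M n) = (\<Sum>n\<le>M. F M n)"
        by (rule suminf_finite) (auto simp: F_def)
      then show ?thesis
        by (simp add: F_def)
    qed
    ultimately show ?thesis
      using suminf_mult2[OF heat_summable[OF assms(1), of x y], of "escape K y"]
      by (simp add: green_def)
  qed
  then have "(\<lambda>M. \<Sum>y\<in>K. \<Sum>n\<le>M. heat n x y * surv K (M - n) y) \<longlonglongrightarrow> (\<Sum>y\<in>K. green x y * escape K y)"
    by (intro tendsto_sum)
  then show "(\<lambda>M. 1 - of_bool (x \<notin> K) * surv K M x) \<longlonglongrightarrow> (\<Sum>y\<in>K. green x y * escape K y)"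
    unfolding last_exit_finite[OF assms(2)] .
qed

text \<open>Symmetry of the Green function exchanges the two equilibrium measures.\<close>

lemma cap_ge_mult_of_hitting:
  fixes K S :: "('d::finite) pt set"
  assumes "CARD('d) \<ge> 3" and K: "finite K" and S: "finite S"
    and hit: "\<And>x. x \<in> K \<Longrightarrow> x \<notin> S \<Longrightarrow> escape S x \<le> 1 - c" and "c \<le> 1"
  shows "c * cap K \<le> cap S"
proof -
  have "c * (\<Sum>x\<in>K. escape K x) = (\<Sum>x\<in>K. escape K x * c)"
    by (simp add: sum_distrib_left mult.commute)
  also have "\<dots> \<le> (\<Sum>x\<in>K. escape K x * (\<Sum>y\<in>S. green x y * escape S y))"
  proof (intro sum_mono mult_left_mono escape_nonneg)
    show "c \<le> (\<Sum>y\<in>S. green x y * escape S y)" if "x \<in> K" for x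
      using hit[OF that] \<open>c \<le> 1\<close> unfolding last_exit[OF assms(1) S] by (cases "x \<in> S") auto
  qed
  also have "\<dots> = (\<Sum>y\<in>S. escape S y * (\<Sum>x\<in>K. green y x * escape K x))"
    unfolding sum_distrib_left by (subst sum.swap, subst green_sym) (simp add: mult_ac)
  also have "\<dots> \<le> (\<Sum>y\<in>S. escape S y * 1)"
    by (intro sum_mono mult_left_mono escape_nonneg)
      (simp add: last_exit[OF assms(1) K] escape_nonneg)
  finally have "c * (\<Sum>x\<in>K. escape K x) \<le> (\<Sum>y\<in>S. escape S y)"
    by simp
  then show ?thesis
    unfolding cap_def by (simp add: mult.left_commute[of c] flip: sum_distrib_left)
qed

section \<open>Capacity of sets that separate from infinity\<close>

lemma surv_le_heat_trapped:
  assumes "finite F" and "\<And>y z. y \<in> F \<Longrightarrow> adj y z \<Longrightarrow> z \<in> F \<union> S" and "x \<in> F"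
  shows "surv S n x \<le> (\<Sum>y\<in>F. heat n x y)"
  using assms(3)
proof (induction n arbitrary: x)
  case 0
  then show ?case
    using assms(1) by simp
next
  case (Suc n)
  have "surv S (Suc n) x \<le> avg (\<lambda>z. \<Sum>y\<in>F. heat n z y) x"
    unfolding surv_Suc
  proof (rule avg_mono)
    fix z assume "adj x z"
    then have "z \<in> F \<union> S"
      using assms(2) Suc.prems by blast
    then show "of_bool (z \<notin> S) * surv S n z \<le> (\<Sum>y\<in>F. heat n z y)"
      using Suc.IH[of z] by (auto simp: sum_nonneg heat_nonneg)
  qed
  then show ?case
    by (simp add: avg_sum)
qed

text \<open>Transience: the probability of still being in the finite set \<open>F\<close> at time
  \<open>n\<close> tends to 0 because the Green function converges, and \<open>F\<close> can only be
  left through \<open>S\<close>.\<close>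

lemma escape_trapped:
  fixes F S :: "('d::finite) pt set"
  assumes "CARD('d) \<ge> 3" and F: "finite F"
    and trap: "\<And>y z. y \<in> F \<Longrightarrow> adj y z \<Longrightarrow> z \<in> F \<union> S" and x: "x \<in> F"
  shows "escape S x = 0"
proof -
  have "(\<lambda>n. \<Sum>y\<in>F. heat n x y) \<longlonglongrightarrow> (\<Sum>y\<in>F. 0)"
    by (intro tendsto_sum summable_LIMSEQ_zero heat_summable assms(1))
  moreover have "surv S n x \<le> (\<Sum>y\<in>F. heat n x y)" for n
    using F trap x by (rule surv_le_heat_trapped)
  ultimately have "escape S x \<le> (\<Sum>y\<in>F. 0)"
    by (intro LIMSEQ_le[OF surv_tendsto]) auto
  then show ?thesis
    using escape_nonneg[of S x] by simp
qed

text \<open>The walk hits \<open>S\<close> almost surely from points of \<open>C\<close> outside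
  \<open>S\<close>, and from the outer boundary of \<open>C\<close> with probability at least
  1/(2d), namely when its first step goes into \<open>C\<close>. This is where the factor 2d is
  lost.\<close>

lemma cap_separating:
  fixes F S C :: "('d::finite) pt set"
  assumes "CARD('d) \<ge> 3" and "finite S" "finite F" "finite (outer_closure C)"
    and trap: "\<And>y z. y \<in> F \<Longrightarrow> adj y z \<Longrightarrow> z \<in> F \<union> S" and "C \<subseteq> F \<union> S"
  shows "cap (outer_closure C) / (2 * real CARD('d)) \<le> cap S"
proof -
  let ?m = "2 * real CARD('d)"
  \<comment> \<open>A point of \<open>C\<close> in \<open>S\<close> is killed by the indicator; any
    other point of \<open>C\<close> lies in \<open>F\<close>, from where the walk cannot
    escape.\<close>
  have zero: "of_bool (z \<notin> S) * escape S z = 0" if "z \<in> C" for z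
    using escape_trapped[OF assms(1,3), of S z] trap that assms(6) by auto
  have "1 / ?m * cap (outer_closure C) \<le> cap S"
  proof (rule cap_ge_mult_of_hitting)
    fix x assume x: "x \<in> outer_closure C" "x \<notin> S"
    show "escape S x \<le> 1 - 1 / ?m"
    proof (cases "x \<in> C")
      case True
      then have "escape S x = 0"
        using zero[of x] x by simp
      then show ?thesis
        using assms(1) by simp
    next
      case False
      then obtain y where y: "y \<in> C" "adj x y"
        using x by (auto simp: outer_closure_def)
      then have yx: "y \<in> nbrs x"
        by (simp add: nbrs_def)
      have "escape S x = (\<Sum>z\<in>nbrs x. of_bool (z \<notin> S) * escape S z) / ?m"
        by (subst escape_step) (simp add: avg_def)
      also have "(\<Sum>z\<in>nbrs x. of_bool (z \<notin> S) * escape S z) =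
          (\<Sum>z\<in>nbrs x - {y}. of_bool (z \<notin> S) * escape S z)"
        using zero[OF y(1)] yx by (subst sum.remove[of _ y]) auto
      also have "\<dots> \<le> (\<Sum>z\<in>nbrs x - {y}. 1)"
        by (intro sum_mono) (auto simp: escape_le_1)
      also have "\<dots> = ?m - 1"
        using yx by (simp add: card_nbrs Suc_le_eq)
      finally show ?thesis
        by (simp add: divide_right_mono diff_divide_distrib)
    qed
  qed (use assms in auto)
  then show ?thesis
    by simp
qed

section \<open>Polynomial bound on the cardinality of a set in terms of its capacity\<close>

lemma finite_cube: "finite {x :: ('d::finite) pt. \<forall>j. x j \<in> {a..b}}"
  and card_cube: "card {x :: ('d::finite) pt. \<forall>j. x j \<in> {a..b}} = nat (b - a + 1) ^ CARD('d)"
proof -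
  have eq: "{x :: 'd pt. \<forall>j. x j \<in> {a..b}} = PiE UNIV (\<lambda>_. {a..b})"
    by (auto simp: PiE_def)
  show "finite {x :: 'd pt. \<forall>j. x j \<in> {a..b}}"
    unfolding eq by (intro finite_PiE) auto
  show "card {x :: 'd pt. \<forall>j. x j \<in> {a..b}} = nat (b - a + 1) ^ CARD('d)"
    unfolding eq by (subst card_PiE) auto
qed

lemma pot_le_1: "pot x \<le> 1"
proof -
  have "pot x \<le> 1 powr (-1/4)"
    unfolding pot_def by (rule powr_mono2') (auto simp: sum_nonneg add_increasing2)
  then show ?thesis
    by simp
qed

text \<open>\<open>pot\<close> decays like the norm to the power -1/2, so a coordinate beyond m^2 is
  what brings it below 1/m.\<close>

lemma pot_le_inverse:
  assumes "\<bar>x j\<bar> > int m ^ 2" and "m > 0"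
  shows "pot x \<le> 1 / real m"
proof -
  have "real m ^ 4 \<le> (real_of_int (x j))\<^sup>2"
  proof -
    have "real_of_int (int m ^ 2) \<le> real_of_int \<bar>x j\<bar>"
      using assms(1) by (intro of_int_le_iff[THEN iffD2]) linarith
    then have "(real m ^ 2) ^ 2 \<le> \<bar>real_of_int (x j)\<bar> ^ 2"
      by (intro power_mono) simp_all
    then show ?thesis
      by simp
  qed
  also have "\<dots> \<le> (\<Sum>l\<in>UNIV. (real_of_int (x l))\<^sup>2)"
    by (rule member_le_sum) auto
  finally have "pot x \<le> (real m ^ 4) powr (-1/4)"
    unfolding pot_def using assms(2) by (intro powr_mono2') auto
  also have "\<dots> = (real m powr 4) powr (-1/4)"
    using assms(2) by simp
  also have "\<dots> = 1 / real m"
    unfolding powr_powr using assms(2) by (simp add: powr_minus_divide)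
  finally show ?thesis .
qed

text \<open>The sum is split at the cube of radius m^2 around \<open>y\<close>: inside,
  \<open>pot\<close> is at most 1 and the volume of the cube counts; outside, each point contributes
  at most 1/m.\<close>

lemma sum_green_le:
  fixes K :: "('d::finite) pt set"
  assumes "CARD('d) \<ge> 3" and K: "finite K" and m: "m > 0"
  shows "(\<Sum>x\<in>K. green x y) \<le> ((2 * real m ^ 2 + 1) ^ CARD('d) + real (card K) / real m) / pot_drop"
proof -
  define Q where "Q = {x :: 'd pt. \<forall>j. x j \<in> {- (int m ^ 2)..int m ^ 2}}"
  define Q' where "Q' = {x :: 'd pt. (\<lambda>j. x j - y j) \<in> Q}"
  have inj: "inj_on (\<lambda>x j. x j - y j) Q'"
    by (auto simp: inj_on_def fun_eq_iff)
  have Qc: "real (card Q) = (2 * real m ^ 2 + 1) ^ CARD('d)"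
  proof -
    have "nat (int m ^ 2 - - (int m ^ 2) + 1) = 2 * m ^ 2 + 1"
      by (simp add: nat_eq_iff)
    then show ?thesis
      unfolding Q_def card_cube by (simp add: add_ac)
  qed
  have finQ: "finite Q"
    unfolding Q_def by (rule finite_cube)
  have im: "(\<lambda>x j. x j - y j) ` Q' \<subseteq> Q"
    by (auto simp: Q'_def)
  have finQ': "finite Q'"
    using finite_imageD[OF finite_subset[OF im finQ] inj] .
  have cQ': "card Q' \<le> card Q"
    using card_inj_on_le[OF inj im finQ] .
  have pot: "pot (\<lambda>j. x j - y j) \<le> 1 / real m" if "x \<notin> Q'" for x
  proof -
    from that obtain j where "\<not> (- (int m ^ 2) \<le> x j - y j \<and> x j - y j \<le> int m ^ 2)"
      unfolding Q'_def Q_def mem_Collect_eq atLeastAtMost_iff by blast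
    then have "\<bar>x j - y j\<bar> > int m ^ 2"
      by linarith
    then show ?thesis
      using pot_le_inverse[of m "\<lambda>j. x j - y j" j] m by simp
  qed
  have "(\<Sum>x\<in>K. green x y) \<le> (\<Sum>x\<in>K. pot (\<lambda>j. x j - y j) / pot_drop)"
    by (intro sum_mono green_le_pot assms(1))
  also have "\<dots> = (\<Sum>x\<in>K. pot (\<lambda>j. x j - y j)) / pot_drop"
    by (simp add: sum_divide_distrib)
  also have "(\<Sum>x\<in>K. pot (\<lambda>j. x j - y j)) \<le> (\<Sum>x\<in>K. of_bool (x \<in> Q') + 1 / real m)"
  proof (rule sum_mono)
    show "pot (\<lambda>j. x j - y j) \<le> of_bool (x \<in> Q') + 1 / real m" for x
      using pot[of x] pot_le_1[of "\<lambda>j. x j - y j"] by (cases "x \<in> Q'") (auto intro: add_increasing2)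
  qed
  also have "\<dots> = real (card (K \<inter> Q')) + real (card K) / real m"
    using K by (simp add: sum.distrib of_bool_def sum.If_cases)
  also have "real (card (K \<inter> Q')) \<le> real (card Q')"
    using finQ' by (simp add: card_mono)
  also have "\<dots> \<le> (2 * real m ^ 2 + 1) ^ CARD('d)"
    using cQ' Qc by simp
  finally show ?thesis
    using pot_drop_pos by (simp add: divide_right_mono)
qed

text \<open>Summing \<open>last_exit\<close> over x in \<open>K\<close>, where its right side is 1,
  expresses the cardinality through escape probabilities and sums of the Green function. The
  condition on \<open>m\<close> makes the term with card K / m at most half of the left side, which
  absorbs it.\<close>

lemma card_le_of_cap:
  fixes K :: "('d::finite) pt set"
  assumes "CARD('d) \<ge> 3" and K: "finite K" and m: "m > 0"
    and cap: "2 * cap K \<le> real m * pot_drop"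
  shows "real (card K) \<le> real m * (2 * real m ^ 2 + 1) ^ CARD('d)"
proof -
  define Z where "Z = (2 * real m ^ 2 + 1) ^ CARD('d) + real (card K) / real m"
  have Z0: "Z \<ge> 0"
    by (simp add: Z_def)
  have "real (card K) = (\<Sum>x\<in>K. \<Sum>y\<in>K. green x y * escape K y)"
    by (simp add: last_exit[OF assms(1) K])
  also have "\<dots> = (\<Sum>y\<in>K. escape K y * (\<Sum>x\<in>K. green x y))"
    unfolding sum_distrib_left by (subst sum.swap) (simp add: mult.commute)
  also have "\<dots> \<le> (\<Sum>y\<in>K. escape K y * (Z / pot_drop))"
    unfolding Z_def by (intro sum_mono mult_left_mono escape_nonneg sum_green_le assms)
  also have "\<dots> = (\<Sum>y\<in>K. escape K y) * (Z / pot_drop)"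
    unfolding sum_distrib_right ..
  also have "\<dots> \<le> cap K * (Z / pot_drop)"
  proof (rule mult_right_mono)
    show "(\<Sum>y\<in>K. escape K y) \<le> cap K"
        unfolding cap_def using assms(1)
      by (intro sum_mono) (simp add: mult_le_cancel_right1 escape_nonneg not_less)
  qed (use Z0 pot_drop_pos in auto)
  also have "\<dots> \<le> (real m * pot_drop / 2) * (Z / pot_drop)"
    using cap Z0 pot_drop_pos by (intro mult_right_mono) auto
  also have "\<dots> = real m * (2 * real m ^ 2 + 1) ^ CARD('d) / 2 + real (card K) / 2"
    using pot_drop_pos m by (simp add: Z_def field_simps)
  finally show ?thesis
    by simp
qed

section \<open>Dyadic cells and the separating set\<close>

text \<open>The box at scale \<open>2 ^ i\<close> with corner \<open>2 ^ i * m\<close> is represented by its index \<open>m\<close>.\<close>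

definition cell :: "nat \<Rightarrow> ('d::finite) pt \<Rightarrow> 'd pt" where
  "cell i x = (\<lambda>j. x j div 2 ^ i)"

definition corner :: "nat \<Rightarrow> ('d::finite) pt \<Rightarrow> 'd pt" where
  "corner i m = (\<lambda>j. 2 ^ i * m j)"

definition children :: "('d::finite) pt set \<Rightarrow> 'd pt set" where
  "children B = {m. cell 1 m \<in> B}"

lemma cell_cell: "cell a (cell i x) = cell (i + a) x"
  by (simp add: cell_def power_add zdiv_zmult2_eq)

lemma cell_mono_eq:
  assumes "cell i x = cell i y" and "i \<le> l"
  shows "cell l x = cell l y"
  using cell_cell[of "l - i" i x] cell_cell[of "l - i" i y] assms by simp

lemma cell_mono_image:
  assumes "cell i x \<in> cell i ` C" and "i \<le> l"
  shows "cell l x \<in> cell l ` C"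
  using assms cell_mono_eq[of i x _ l] by blast

lemma cell_corner [simp]: "cell i (corner i m) = m"
  by (simp add: cell_def corner_def)

lemma inj_corner: "inj (corner i)"
  by (rule inj_on_inverseI[of _ "cell i"]) simp

lemma box_corner: "box (2 ^ i) (corner i m) = {x. cell i x = m}"
proof (rule set_eqI)
  fix x :: "'a pt"
  have "2 ^ i * m j \<le> x j \<and> x j < 2 ^ i * m j + 2 ^ i \<longleftrightarrow> x j div 2 ^ i = m j" for j
  proof -
    have p: "(2::int) ^ i > 0"
      by simp
    show ?thesis
    proof
      assume "2 ^ i * m j \<le> x j \<and> x j < 2 ^ i * m j + 2 ^ i"
      then show "x j div 2 ^ i = m j"
        by (intro int_div_pos_eq[of _ _ _ "x j - 2 ^ i * m j"]) auto
    next
      assume "x j div 2 ^ i = m j"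
      then have "2 ^ i * m j + x j mod 2 ^ i = x j"
        using mult_div_mod_eq[of "2 ^ i" "x j"] by simp
      then show "2 ^ i * m j \<le> x j \<and> x j < 2 ^ i * m j + 2 ^ i"
        using pos_mod_bound[OF p, of "x j"] pos_mod_sign[OF p, of "x j"] by linarith
    qed
  qed
  then show "x \<in> box (2 ^ i) (corner i m) \<longleftrightarrow> x \<in> {x. cell i x = m}"
    by (simp add: box_def corner_def cell_def fun_eq_iff)
qed

lemma corner_in_lattice [simp]: "corner i m \<in> lattice (2 ^ i)"
  by (simp add: corner_def lattice_def)

lemma lattice_eq: "lattice (2 ^ i) = range (corner i)"
proof (intro equalityI subsetI)
  fix z :: "'a pt"
  assume "z \<in> lattice (2 ^ i)"
  then have "z = corner i (cell i z)"
    by (auto simp: lattice_def corner_def cell_def)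
  then show "z \<in> range (corner i)"
    by blast
qed auto

lemma l1dist_corner: "l1dist (corner i m) (corner i m') = 2 ^ i * l1dist m m'"
proof -
  have "int (l1dist (corner i m) (corner i m')) = 2 ^ i * int (l1dist m m')"
    unfolding l1dist_sum by (simp add: corner_def abs_mult sum_distrib_left flip: right_diff_distrib)
  also have "\<dots> = int (2 ^ i * l1dist m m')"
    by simp
  finally show ?thesis
    by (rule of_nat_eq_iff[THEN iffD1])
qed

lemma box_adj_corner: "box_adj (2 ^ i) (corner i m) (corner i m') \<longleftrightarrow> adj m m'"
  by (simp add: box_adj_def adj_def l1dist_corner)

lemma div_step:
  fixes a s p :: int
  assumes "s \<in> {1, -1}" and "p > 0"
  shows "(a + s) div p - a div p \<in> {-1, 0, 1}"
proof -
  have "(a + s) div p \<le> (a + p) div p" "(a + - p) div p \<le> (a + s) div p"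
    using assms by (intro zdiv_mono1; auto)+
  moreover have "(a + p) div p = a div p + 1" "(a + - p) div p = a div p - 1"
    using assms div_mult_self1[of p a 1] div_mult_self1[of p a "-1"] by auto
  ultimately show ?thesis
    by auto
qed

lemma cell_adj:
  assumes "adj x y"
  shows "cell i x = cell i y \<or> adj (cell i x) (cell i y)"
proof -
  obtain j s where s: "s \<in> {1, -1}" and y: "y = x(j := x j + s)"
    using assms unfolding adj_upd_iff by blast
  define r where "r = (x j + s) div 2 ^ i - x j div 2 ^ i"
  have eq: "cell i y = (cell i x)(j := cell i x j + r)"
    by (auto simp: cell_def y r_def fun_eq_iff)
  have "r \<in> {-1, 0, 1}"
    unfolding r_def by (rule div_step[OF s]) simp
  then consider "r = 0" | "r \<in> {1, -1}"
    by auto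
  then show ?thesis
    by cases (use eq adj_upd_iff in auto)
qed

lemma finite_box: "finite (box L (z :: ('d::finite) pt))"
  and card_box: "card (box L (z :: ('d::finite) pt)) = L ^ CARD('d)"
proof -
  have eq: "box L z = PiE UNIV (\<lambda>j. {z j..<z j + int L})"
    by (auto simp: box_def PiE_def)
  show "finite (box L z)"
    unfolding eq by (intro finite_PiE) auto
  show "card (box L z) = L ^ CARD('d)"
    unfolding eq by (subst card_PiE) auto
qed

lemma cell_preimage_eq: "{y. cell i y \<in> B} = (\<Union>m\<in>B. box (2 ^ i) (corner i m))"
  by (auto simp: box_corner)

lemma finite_cell_preimage: "finite B \<Longrightarrow> finite {y. cell i y \<in> B}"
  unfolding cell_preimage_eq by (auto intro: finite_box)

lemma card_cell_preimage:
  fixes B :: "('d::finite) pt set"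
  assumes "finite B"
  shows "card {y. cell i y \<in> B} \<le> card B * (2 ^ i) ^ CARD('d)"
proof -
  have "card {y. cell i y \<in> B} \<le> (\<Sum>m\<in>B. card (box (2 ^ i) (corner i m)))"
    unfolding cell_preimage_eq using assms by (rule card_UN_le)
  then show ?thesis
    by (simp add: card_box)
qed

lemma finite_children: "finite B \<Longrightarrow> finite (children B)"
  unfolding children_def by (rule finite_cell_preimage)

lemma card_children: "finite B \<Longrightarrow> card (children B) \<le> card B * 2 ^ CARD('d)"
  for B :: "('d::finite) pt set"
  unfolding children_def using card_cell_preimage[of B 1] by simp

text \<open>The setting of one fixed configuration: \<open>b i\<close> and \<open>v i\<close> are
  the indices of the boxes of scale 2^i whose bad or very bad event occurs. The axioms
  \<open>disjoint\<close>, \<open>boundary\<close> and \<open>spread\<close> are the admissibility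
  conditions (i), (ii), (iii), the last two only for scales between \<open>s\<close> and
  \<open>k\<close>.\<close>

locale coarse_graining =
  fixes C :: "('d::finite) pt set" and b v :: "nat \<Rightarrow> 'd pt set" and s k :: nat
  assumes finite_C: "finite C"
    and disjoint: "\<And>i. b i \<inter> v i = {}"
    and boundary: "\<And>i m m'. \<lbrakk>s \<le> i; i \<le> k; m \<in> cell i ` C; m' \<notin> cell i ` C; adj m m'\<rbrakk> \<Longrightarrow> m \<in> b i \<union> v i"
    and spread: "\<And>i m m'. \<lbrakk>s \<le> i; i \<le> k; m \<in> cell i ` C; m' \<in> cell i ` C; adj m m'; m \<in> b i\<rbrakk>
      \<Longrightarrow> m' \<in> b i \<union> v i"
    and s_le_k: "s \<le> k"
begin

text \<open>The top-down subdivision from scale \<open>k\<close> reaches a cell only through bad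
  ancestors. \<open>Bs i\<close> collects the cells it reaches that are bad themselves and are split
  further, \<open>Vs i\<close> those that are very bad and are kept.\<close>

definition Bs :: "nat \<Rightarrow> 'd pt set" where
  "Bs i = cell i ` {x \<in> C. \<forall>l\<in>{i..k}. cell l x \<in> b l}"

definition Vs :: "nat \<Rightarrow> 'd pt set" where
  "Vs i = cell i ` {x \<in> C. cell i x \<in> v i \<and> (\<forall>l\<in>{i<..k}. cell l x \<in> b l)}"

definition VS :: "'d pt set" where
  "VS = {y. \<exists>i\<in>{s..k}. cell i y \<in> Vs i}"

definition BS :: "'d pt set" where
  "BS = {y. cell s y \<in> Bs s}"

text \<open>Reading the scales of a point from the top downwards, the first one whose cell is not of type \<open>b\<close>
  inside the coarse cluster decides: the cell lies outside the coarse cluster (free), it is of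
  type \<open>v\<close>, or none of the events occurs there (trapped).\<close>

definition trapped :: "'d pt set" where
  "trapped = {y. \<exists>i\<in>{s..k}. cell i y \<in> cell i ` C \<and> cell i y \<notin> b i \<union> v i \<and> (\<forall>l\<in>{i<..k}. cell l y \<in> b l)}"

definition free :: "'d pt set" where
  "free = {y. \<exists>i\<in>{s..k}. cell i y \<notin> cell i ` C \<and> (\<forall>l\<in>{i<..k}. cell l y \<in> b l \<inter> cell l ` C)}"

lemma finite_Bs: "finite (Bs i)" and finite_Vs: "finite (Vs i)"
  using finite_C by (simp_all add: Bs_def Vs_def)

lemma finite_VS: "finite VS"
proof -
  have "VS = (\<Union>i\<in>{s..k}. {y. cell i y \<in> Vs i})"
    by (auto simp: VS_def)
  then show ?thesis
    by (simp add: finite_cell_preimage finite_Vs)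
qed

lemma finite_BS: "finite BS"
  unfolding BS_def by (rule finite_cell_preimage[OF finite_Bs])

lemma finite_trapped: "finite trapped"
proof (rule finite_subset)
  show "trapped \<subseteq> (\<Union>i\<in>{s..k}. {y. cell i y \<in> cell i ` C})"
    by (auto simp: trapped_def)
  show "finite (\<Union>i\<in>{s..k}. {y. cell i y \<in> cell i ` C})"
    using finite_C by (auto intro: finite_cell_preimage)
qed

text \<open>Points with the same cell at scale \<open>i\<close> share all coarser cells, so the
  representative in \<open>C\<close> may be exchanged for any point of the cell.\<close>

lemma cell_in_Bs_iff: "cell i y \<in> Bs i \<longleftrightarrow> cell i y \<in> cell i ` C \<and> (\<forall>l\<in>{i..k}. cell l y \<in> b l)"
proof
  assume "cell i y \<in> Bs i"
  then obtain x where x: "x \<in> C" "\<forall>l\<in>{i..k}. cell l x \<in> b l" "cell i y = cell i x"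
    by (auto simp: Bs_def)
  then show "cell i y \<in> cell i ` C \<and> (\<forall>l\<in>{i..k}. cell l y \<in> b l)"
    using cell_mono_eq[OF x(3)] by auto
next
  assume r: "cell i y \<in> cell i ` C \<and> (\<forall>l\<in>{i..k}. cell l y \<in> b l)"
  then obtain x where x: "x \<in> C" "cell i y = cell i x"
    by auto
  then show "cell i y \<in> Bs i"
    using r cell_mono_eq[OF x(2)] unfolding Bs_def by (auto intro!: image_eqI[of _ _ x])
qed

lemma cell_in_Vs_iff:
  "cell i y \<in> Vs i \<longleftrightarrow> cell i y \<in> cell i ` C \<and> cell i y \<in> v i \<and> (\<forall>l\<in>{i<..k}. cell l y \<in> b l)"
proof
  assume "cell i y \<in> Vs i"
  then obtain x where x: "x \<in> C" "cell i x \<in> v i" "\<forall>l\<in>{i<..k}. cell l x \<in> b l" "cell i y = cell i x"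
    by (auto simp: Vs_def)
  then show "cell i y \<in> cell i ` C \<and> cell i y \<in> v i \<and> (\<forall>l\<in>{i<..k}. cell l y \<in> b l)"
    using cell_mono_eq[OF x(4)] by auto
next
  assume r: "cell i y \<in> cell i ` C \<and> cell i y \<in> v i \<and> (\<forall>l\<in>{i<..k}. cell l y \<in> b l)"
  then obtain x where x: "x \<in> C" "cell i y = cell i x"
    by auto
  then show "cell i y \<in> Vs i"
    using r cell_mono_eq[OF x(2)] unfolding Vs_def by (auto intro!: image_eqI[of _ _ x])
qed

lemma Bs_children: "i < k \<Longrightarrow> Bs i \<subseteq> children (Bs (Suc i))"
  by (auto simp: Bs_def children_def cell_cell)

lemma Vs_children: "i < k \<Longrightarrow> Vs i \<subseteq> children (Bs (Suc i))"
  by (auto simp: Bs_def Vs_def children_def cell_cell)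

lemma Bs_subset: "i \<le> k \<Longrightarrow> Bs i \<subseteq> b i \<inter> cell i ` C"
  by (auto simp: Bs_def)

lemma Vs_subset: "Vs i \<subseteq> v i \<inter> cell i ` C"
  by (auto simp: Vs_def)

lemma cover: "y \<in> trapped \<or> y \<in> free \<or> y \<in> VS \<union> BS"
proof (cases "\<forall>l\<in>{s..k}. cell l y \<in> b l \<inter> cell l ` C")
  case True
  then have "y \<in> BS"
    using s_le_k by (simp add: BS_def cell_in_Bs_iff)
  then show ?thesis
    by simp
next
  case False
  define X where "X = {l\<in>{s..k}. cell l y \<notin> b l \<inter> cell l ` C}"
  have X: "finite X" "X \<noteq> {}"
    using False by (auto simp: X_def)
  define i where "i = Max X"
  have "i \<in> X"
    unfolding i_def using X by (rule Max_in)
  then have i: "i \<in> {s..k}" "cell i y \<notin> b i \<inter> cell i ` C"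
    by (auto simp: X_def)
  have up: "\<forall>l\<in>{i<..k}. cell l y \<in> b l \<inter> cell l ` C"
  proof (intro ballI, rule ccontr)
    fix l assume l: "l \<in> {i<..k}" "cell l y \<notin> b l \<inter> cell l ` C"
    then have "l \<in> X"
      using i by (auto simp: X_def)
    then have "l \<le> i"
      unfolding i_def using X by simp
    then show False
      using l by simp
  qed
  show ?thesis
  proof (cases "cell i y \<in> cell i ` C")
    case False
    then have "y \<in> free"
      using i up by (auto simp: free_def)
    then show ?thesis
      by simp
  next
    case True
    show ?thesis
    proof (cases "cell i y \<in> v i")
      case v: True
      then have "y \<in> VS"
        using True i up by (auto simp: VS_def cell_in_Vs_iff)
      then show ?thesis
        by simp
    next
      case False
      then have "y \<in> trapped"
        using True i up unfolding trapped_def by blast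
      then show ?thesis
        by simp
    qed
  qed
qed

text \<open>The only use of admissibility. Let \<open>i\<close> be the scale where y lies in an
  eventless cell and \<open>l\<close> the scale where z leaves the coarse cluster. If l < i, the
  cell of z at scale \<open>i\<close> is bad and in the coarse cluster, so by \<open>spread\<close>
  an event occurs at the cell of y. If i <= l, then z is outside the coarse cluster at the finer
  scale \<open>i\<close> too, and \<open>boundary\<close> yields the event.\<close>

lemma trapped_not_adj_free:
  assumes "y \<in> trapped" and "z \<in> free" and "adj y z"
  shows False
proof -
  obtain i where i: "i \<in> {s..k}" "cell i y \<in> cell i ` C" "cell i y \<notin> b i \<union> v i"
    using assms(1) by (auto simp: trapped_def)
  obtain l where l: "l \<in> {s..k}" "cell l z \<notin> cell l ` C" "\<forall>l'\<in>{l<..k}. cell l' z \<in> b l' \<inter> cell l' ` C"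
    using assms(2) unfolding free_def by blast
  have near: "cell i z = cell i y \<or> adj (cell i y) (cell i z)"
    using cell_adj[OF assms(3), of i] by auto
  show False
  proof (cases "l < i")
    case True
    then have z: "cell i z \<in> b i" "cell i z \<in> cell i ` C"
      using l i by auto
    then show False
      using near i spread[of i "cell i z" "cell i y"] by (auto simp: adj_sym)
  next
    case False
    then have "cell i z \<notin> cell i ` C"
      using cell_mono_image[of i z C l] l by auto
    then show False
      using near i boundary[of i "cell i y" "cell i z"] by auto
  qed
qed

lemma C_subset: "C \<subseteq> trapped \<union> (VS \<union> BS)"
proof
  fix x assume "x \<in> C"
  then have "x \<notin> free"
    by (auto simp: free_def)
  then show "x \<in> trapped \<union> (VS \<union> BS)"
    using cover[of x] by auto
qed

text \<open>Here \<open>trapped\<close> is the finite set in which the walk is caught: by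
  \<open>cover\<close>, a neighbour of a trapped point that is neither trapped nor free belongs to
  \<open>VS\<close> or \<open>BS\<close>.\<close>

lemma cap_VS_BS:
  assumes "CARD('d) \<ge> 3" and "finite (outer_closure C)"
  shows "cap (outer_closure C) / (2 * real CARD('d)) \<le> cap (VS \<union> BS)"
proof (rule cap_separating[OF assms(1) _ finite_trapped assms(2) _ C_subset])
  show "finite (VS \<union> BS)"
    using finite_VS finite_BS by simp
  show "z \<in> trapped \<union> (VS \<union> BS)" if "y \<in> trapped" "adj y z" for y z
    using cover[of z] trapped_not_adj_free[OF that(1) _ that(2)] by auto
qed

lemma cap_BS_le: "cap BS \<le> 2 * real CARD('d) * (real (card (Bs s)) * (2 ^ s) ^ CARD('d))"
proof -
  have "cap BS \<le> 2 * real CARD('d) * real (card BS)"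
    by (rule cap_le_card)
  also have "\<dots> \<le> 2 * real CARD('d) * real (card (Bs s) * (2 ^ s) ^ CARD('d))"
    unfolding BS_def by (intro mult_left_mono of_nat_mono card_cell_preimage finite_Bs) simp
  finally show ?thesis
    by simp
qed

end

section \<open>Families of multiscale interfaces and their entropy\<close>

definition scaled :: "nat \<Rightarrow> ('d::finite) pt set \<Rightarrow> (nat \<times> 'd pt) set" where
  "scaled i V = (\<lambda>m. (2 ^ i, corner i m)) ` V"

lemma card_scaled: "card (scaled i V) = card V"
  unfolding scaled_def by (rule card_image) (auto simp: inj_on_def dest: injD[OF inj_corner])

text \<open>At level \<open>s + n\<close> one selects the very bad cells \<open>V\<close> and the few bad cells \<open>B\<close> to be subdivided; all
  cells of the next level are children of \<open>B\<close>.  Hence the entropy is controlled by the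
  numbers \<open>\<tau>\<close> of subdivided cells, with no cost for their location.\<close>

primrec interface_family :: "(nat \<Rightarrow> real) \<Rightarrow> nat \<Rightarrow> nat \<Rightarrow> ('d::finite) pt set \<Rightarrow> (nat \<times> 'd pt) set set" where
  "interface_family \<tau> s 0 R = {scaled s V | V. V \<subseteq> R}"
| "interface_family \<tau> s (Suc n) R = {scaled (s + Suc n) V \<union> I | V B I.
     V \<subseteq> R \<and> B \<subseteq> R \<and> real (card B) \<le> \<tau> (s + Suc n) \<and> I \<in> interface_family \<tau> s n (children B)}"

text \<open>The same quantity \<open>e\<close> controls size and entropy. At the top level there are
  at most 2 ^ card R choices for each of \<open>V\<close> and \<open>B\<close>, whence the base 4;
  the next level starts from at most 2^d \<tau> cells, whatever \<open>R\<close> was.\<close>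

lemma interface_family_bounds:
  fixes R :: "('d::finite) pt set" and \<tau> :: "nat \<Rightarrow> real" and s n :: nat
  assumes "finite R"
  defines "e \<equiv> \<lambda>n R. real (card R) + 2 ^ CARD('d) * (\<Sum>i=1..n. \<tau> (s + i))"
  shows "finite (interface_family \<tau> s n R) \<and> real (card (interface_family \<tau> s n R)) \<le> 4 powr e n R \<and>
    (\<forall>I\<in>interface_family \<tau> s n R. finite I \<and> real (card I) \<le> e n R \<and> (\<forall>(L, z)\<in>I. 2 ^ s \<le> L))"
  using assms(1)
proof (induction n arbitrary: R)
  case 0
  have eq: "interface_family \<tau> s 0 R = scaled s ` Pow R"
    by auto
  have "card (interface_family \<tau> s 0 R) \<le> 2 ^ card R"
    unfolding eq using card_image_le[of "Pow R" "scaled s"] 0 by (simp add: card_Pow)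
  then have "real (card (interface_family \<tau> s 0 R)) \<le> 2 ^ card R"
    by (metis of_nat_le_iff of_nat_numeral of_nat_power)
  also have "\<dots> \<le> 4 ^ card R"
    by (rule power_mono) auto
  finally have "real (card (interface_family \<tau> s 0 R)) \<le> 4 powr e 0 R"
    by (simp add: e_def powr_realpow)
  moreover have "finite I \<and> real (card I) \<le> e 0 R \<and> (\<forall>(L, z)\<in>I. 2 ^ s \<le> L)"
    if "I \<in> interface_family \<tau> s 0 R" for I
  proof -
    obtain V where V: "V \<subseteq> R" "I = scaled s V"
      using \<open>I \<in> interface_family \<tau> s 0 R\<close> by auto
    have "finite V" "card V \<le> card R"
      using V(1) 0 by (auto intro: finite_subset card_mono)
    then show ?thesis
      unfolding V(2) by (auto simp: e_def card_scaled) (auto simp: scaled_def)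
  qed
  ultimately show ?case
    unfolding eq using 0 by auto
next
  case (Suc n)
  define X where "X = {B. B \<subseteq> R \<and> real (card B) \<le> \<tau> (s + Suc n)}"
  \<comment> \<open>A bound for \<open>e n (children B)\<close> that is uniform over
    \<open>B\<close> in \<open>X\<close>; by construction \<open>e (Suc n) R\<close> is
    \<open>card R\<close> plus \<open>E\<close>.\<close>
  define E where "E = 2 ^ CARD('d) * (\<Sum>i=1..Suc n. \<tau> (s + i))"
  have X: "finite X" "card X \<le> 2 ^ card R"
  proof -
    have "X \<subseteq> Pow R"
      by (auto simp: X_def)
    then show "finite X" "card X \<le> 2 ^ card R"
      using Suc.prems card_mono[of "Pow R" X] by (auto simp: card_Pow intro: finite_subset)
  qed
  have ch: "finite (children B) \<and> e n (children B) \<le> E" if "B \<in> X" for B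
  proof -
    have B: "finite B" "real (card B) \<le> \<tau> (s + Suc n)"
      using that Suc.prems by (auto simp: X_def intro: finite_subset)
    have "real (card (children B)) \<le> real (card B) * 2 ^ CARD('d)"
      using of_nat_mono[OF card_children[OF B(1)], where 'a = real] by simp
    also have "\<dots> \<le> \<tau> (s + Suc n) * 2 ^ CARD('d)"
      using B(2) by (rule mult_right_mono) simp
    finally show ?thesis
      using B(1) by (simp add: e_def E_def finite_children algebra_simps)
  qed
  have IH: "finite (interface_family \<tau> s n (children B))" "real (card (interface_family \<tau> s n (children B))) \<le> 4 powr E"
    "I \<in> interface_family \<tau> s n (children B) \<Longrightarrow> finite I \<and> real (card I) \<le> E \<and> (\<forall>(L, z)\<in>I. 2 ^ s \<le> L)"
    if "B \<in> X" for B I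
  proof -
    have "4 powr e n (children B) \<le> 4 powr E"
      using ch[OF that] by (intro powr_mono) auto
    moreover note ih = Suc.IH[OF ch[OF that, THEN conjunct1]]
    ultimately show "finite (interface_family \<tau> s n (children B))" "real (card (interface_family \<tau> s n (children B))) \<le> 4 powr E"
      by (blast, linarith)
    assume "I \<in> interface_family \<tau> s n (children B)"
    with ih have "finite I \<and> real (card I) \<le> e n (children B) \<and> (\<forall>(L, z)\<in>I. 2 ^ s \<le> L)"
      by blast
    then show "finite I \<and> real (card I) \<le> E \<and> (\<forall>(L, z)\<in>I. 2 ^ s \<le> L)"
      using ch[OF that] by linarith
  qed
  define Y where "Y = (SIGMA B:X. interface_family \<tau> s n (children B))"
  have Y: "finite Y"
    unfolding Y_def using X IH by blast
  have "real (card Y) = (\<Sum>B\<in>X. real (card (interface_family \<tau> s n (children B))))"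
    unfolding Y_def using X IH by (subst card_SigmaI) auto
  also have "\<dots> \<le> (\<Sum>B\<in>X. 4 powr E)"
    by (intro sum_mono IH)
  also have "\<dots> \<le> 2 ^ card R * 4 powr E"
    using of_nat_mono[OF X(2), where 'a = real] by (simp add: mult_right_mono)
  finally have cY: "real (card Y) \<le> 2 ^ card R * 4 powr E" .
  have eq: "interface_family \<tau> s (Suc n) R = (\<lambda>(V, B, I). scaled (s + Suc n) V \<union> I) ` (Pow R \<times> Y)"
  proof (intro equalityI subsetI)
    fix I assume "I \<in> interface_family \<tau> s (Suc n) R"
    then obtain V B J where "V \<subseteq> R" "B \<in> X" "J \<in> interface_family \<tau> s n (children B)" "I = scaled (s + Suc n) V \<union> J"
      by (auto simp: X_def)
    then show "I \<in> (\<lambda>(V, B, I). scaled (s + Suc n) V \<union> I) ` (Pow R \<times> Y)"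
      by (intro image_eqI[of _ _ "(V, B, J)"]) (auto simp: Y_def)
  next
    fix I assume "I \<in> (\<lambda>(V, B, I). scaled (s + Suc n) V \<union> I) ` (Pow R \<times> Y)"
    then obtain V B J where "V \<subseteq> R" "B \<in> X" "J \<in> interface_family \<tau> s n (children B)" "I = scaled (s + Suc n) V \<union> J"
      by (auto simp: Y_def)
    then show "I \<in> interface_family \<tau> s (Suc n) R"
      by (auto simp: X_def)
  qed
  have fin: "finite (interface_family \<tau> s (Suc n) R)"
    unfolding eq using Y Suc.prems by auto
  have "card (interface_family \<tau> s (Suc n) R) \<le> card (Pow R \<times> Y)"
    unfolding eq using Y Suc.prems by (intro card_image_le) auto
  then have "real (card (interface_family \<tau> s (Suc n) R)) \<le> real (card (Pow R \<times> Y))"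
    by (rule of_nat_mono)
  also have "\<dots> = 2 ^ card R * real (card Y)"
    using Suc.prems by (simp add: card_cartesian_product card_Pow)
  also have "\<dots> \<le> 2 ^ card R * (2 ^ card R * 4 powr E)"
    by (intro mult_left_mono cY) simp
  also have "\<dots> = 4 ^ card R * 4 powr E"
    using power_mult_distrib[of 2 "2 :: real" "card R"] by simp
  also have "\<dots> = 4 powr e (Suc n) R"
    unfolding e_def E_def powr_add by (simp add: powr_realpow)
  finally have card: "real (card (interface_family \<tau> s (Suc n) R)) \<le> 4 powr e (Suc n) R" .
  have "finite I \<and> real (card I) \<le> e (Suc n) R \<and> (\<forall>(L, z)\<in>I. 2 ^ s \<le> L)"
    if I: "I \<in> interface_family \<tau> s (Suc n) R" for I
  proof -
    obtain V B J where VBJ: "V \<subseteq> R" "B \<in> X" "J \<in> interface_family \<tau> s n (children B)" "I = scaled (s + Suc n) V \<union> J"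
      using I by (auto simp: X_def)
    have J: "finite J" "real (card J) \<le> E" "\<forall>(L, z)\<in>J. 2 ^ s \<le> L"
      using IH(3)[OF VBJ(2,3)] by auto
    have V: "finite V" "card V \<le> card R"
      using VBJ(1) Suc.prems by (auto intro: finite_subset card_mono)
    have "card I \<le> card V + card J"
      unfolding VBJ(4) using card_Un_le[of "scaled (s + Suc n) V" J] by (simp add: card_scaled)
    then have "real (card I) \<le> e (Suc n) R"
      using J(2) V(2) by (simp add: e_def E_def)
    moreover have "(2::nat) ^ s \<le> 2 ^ (s + Suc n)"
      by (rule power_increasing) auto
    moreover have "finite I"
      using J(1) V(1) unfolding VBJ(4) scaled_def by simp
    moreover have "\<forall>(L, z)\<in>I. 2 ^ s \<le> L"
      using J(3) \<open>(2::nat) ^ s \<le> 2 ^ (s + Suc n)\<close> unfolding VBJ(4) scaled_def by blast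
    ultimately show ?thesis
      by blast
  qed
  then show ?case
    using fin card by blast
qed

text \<open>The cardinality bound on \<open>B\<close> starts strictly above \<open>s\<close>,
  because nothing is subdivided at the lowest scale.\<close>

lemma interface_familyI:
  fixes V B :: "nat \<Rightarrow> ('d::finite) pt set"
  assumes "\<And>i. \<lbrakk>s \<le> i; i < s + n\<rbrakk> \<Longrightarrow> V i \<subseteq> children (B (Suc i))"
    and "\<And>i. \<lbrakk>s \<le> i; i < s + n\<rbrakk> \<Longrightarrow> B i \<subseteq> children (B (Suc i))"
    and "\<And>i. \<lbrakk>s < i; i \<le> s + n\<rbrakk> \<Longrightarrow> real (card (B i)) \<le> \<tau> i"
    and "V (s + n) \<subseteq> R" and "B (s + n) \<subseteq> R"
  shows "(\<Union>i\<in>{s..s + n}. scaled i (V i)) \<in> interface_family \<tau> s n R"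
  using assms
proof (induction n arbitrary: R)
  case 0
  then show ?case
    by auto
next
  case (Suc n)
  have "(\<Union>i\<in>{s..s + n}. scaled i (V i)) \<in> interface_family \<tau> s n (children (B (s + Suc n)))"
    using Suc.prems by (intro Suc.IH) auto
  moreover have "(\<Union>i\<in>{s..s + Suc n}. scaled i (V i)) =
      scaled (s + Suc n) (V (s + Suc n)) \<union> (\<Union>i\<in>{s..s + n}. scaled i (V i))"
    by (auto simp: atLeastAtMostSuc_conv)
  moreover have "real (card (B (s + Suc n))) \<le> \<tau> (s + Suc n)"
    by (rule Suc.prems(3)) auto
  ultimately show ?case
    unfolding interface_family.simps using Suc.prems(4,5) by blast
qed

section \<open>Clusters and interfaces\<close>

lemma l1dist_triangle: "l1dist x z \<le> l1dist x y + l1dist y z"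
proof -
  have "int (l1dist x z) \<le> int (l1dist x y) + int (l1dist y z)"
    unfolding l1dist_sum sum.distrib[symmetric] by (rule sum_mono) linarith
  then show ?thesis
    by linarith
qed

lemma l1dist_commute: "l1dist x y = l1dist y x"
  by (simp add: l1dist_def abs_minus_commute)

lemma abs_coord_le_l1dist: "\<bar>x j\<bar> \<le> int (l1dist origin x)"
proof -
  have "\<bar>x j\<bar> = \<bar>origin j - x j\<bar>"
    by (simp add: origin_def)
  also have "\<dots> \<le> (\<Sum>l\<in>UNIV. \<bar>origin l - x l\<bar>)"
    by (rule member_le_sum) auto
  finally show ?thesis
    by (simp add: l1dist_sum)
qed

text \<open>Discrete intermediate values: along a path in the cluster the distance to the origin
  grows by at most 1 per step.\<close>

lemma cluster_distances:
  assumes "y \<in> cluster \<phi> h" and "n \<le> l1dist origin y"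
  shows "\<exists>z\<in>cluster \<phi> h. l1dist origin z = n"
proof -
  have h: "h \<le> \<phi> origin"
    and conn: "(\<lambda>a b. adj a b \<and> h \<le> \<phi> a \<and> h \<le> \<phi> b)\<^sup>*\<^sup>* origin y"
    using assms(1) by (auto simp: cluster_def)
  from conn assms(2) show ?thesis
  proof (induction rule: rtranclp_induct)
    case base
    then show ?case
      using h by (intro bexI[of _ origin]) (auto simp: cluster_def l1dist_def)
  next
    case (step y z)
    have "l1dist origin z \<le> l1dist origin y + 1"
      using l1dist_triangle[of origin z y] step.hyps(2) by (simp add: adj_def)
    moreover have "z \<in> cluster \<phi> h"
      using h step.hyps unfolding cluster_def by (blast intro: rtranclp.rtrancl_into_rtrancl)
    ultimately show ?case
      using step.IH step.prems by (cases "n \<le> l1dist origin y") (auto intro!: bexI[of _ z])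
  qed
qed

lemma l1dist_lt_card_cluster:
  assumes "finite (cluster \<phi> h)" and "y \<in> cluster \<phi> h"
  shows "l1dist origin y < card (cluster \<phi> h)"
proof -
  have "{..l1dist origin y} \<subseteq> l1dist origin ` cluster \<phi> h"
    using cluster_distances[OF assms(2)] by force
  then have "card {..l1dist origin y} \<le> card (cluster \<phi> h)"
    by (rule surj_card_le[OF assms(1)])
  then show ?thesis
    by simp
qed

lemma diam_finite:
  assumes "finite S" and "S \<noteq> {}"
  obtains x y where "x \<in> S" "y \<in> S" "diam S = enat (l1dist x y)"
    "\<And>u w. u \<in> S \<Longrightarrow> w \<in> S \<Longrightarrow> l1dist u w \<le> l1dist x y"
proof -
  let ?f = "\<lambda>p. enat (l1dist (fst p) (snd p))"
  have fin: "finite (?f ` (S \<times> S))" "?f ` (S \<times> S) \<noteq> {}"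
    using assms by auto
  have eq: "diam S = Max (?f ` (S \<times> S))"
    unfolding diam_def by (rule Max_Sup[OF fin, symmetric])
  then have "diam S \<in> ?f ` (S \<times> S)"
    using Max_in[OF fin] by simp
  then obtain x y where xy: "x \<in> S" "y \<in> S" "diam S = enat (l1dist x y)"
    by auto
  have "l1dist u w \<le> l1dist x y" if "u \<in> S" "w \<in> S" for u w
  proof -
    have "?f (u, w) \<le> diam S"
      unfolding eq using that by (intro Max_ge[OF fin(1)] imageI) auto
    then show ?thesis
      by (simp add: xy(3))
  qed
  with xy show ?thesis
    by (rule that)
qed

lemma finite_outer_closure:
  assumes "finite S"
  shows "finite (outer_closure S)"
proof (rule finite_subset)
  show "outer_closure S \<subseteq> S \<union> (\<Union>y\<in>S. nbrs y)"
    by (auto simp: outer_closure_def nbrs_def adj_sym)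
qed (use assms in auto)

lemma coarse_cluster_eq: "coarse_cluster \<phi> h (2 ^ i) = corner i ` cell i ` cluster \<phi> h"
  unfolding coarse_cluster_def lattice_eq by (auto simp: box_corner)

lemma corner_in_coarse_cluster: "corner i m \<in> coarse_cluster \<phi> h (2 ^ i) \<longleftrightarrow> m \<in> cell i ` cluster \<phi> h"
  unfolding coarse_cluster_eq using inj_image_mem_iff[OF inj_corner] .

lemma is_interface_UN_scaled:
  assumes "finite X" and "\<And>i. i \<in> X \<Longrightarrow> finite (V i)"
    and "\<And>i l x. \<lbrakk>i \<in> X; l \<in> X; i < l; cell i x \<in> V i; cell l x \<in> V l\<rbrakk> \<Longrightarrow> False"
  shows "is_interface (\<Union>i\<in>X. scaled i (V i))"
proof -
  have "box (fst c) (snd c) \<inter> box (fst c') (snd c') = {}"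
    if mem: "c \<in> (\<Union>i\<in>X. scaled i (V i))" "c' \<in> (\<Union>i\<in>X. scaled i (V i))" and neq: "c \<noteq> c'" for c c'
  proof (rule ccontr)
    assume meet: "\<not> ?thesis"
    obtain i m where c: "i \<in> X" "m \<in> V i" "c = (2 ^ i, corner i m)"
      using mem(1) by (auto simp: scaled_def)
    obtain l m' where c': "l \<in> X" "m' \<in> V l" "c' = (2 ^ l, corner l m')"
      using mem(2) by (auto simp: scaled_def)
    from meet obtain x where "cell i x = m" "cell l x = m'"
      unfolding c(3) c'(3) fst_conv snd_conv box_corner by blast
    then show False
      using assms(3)[of i l x] assms(3)[of l i x] c c' neq by (cases i l rule: linorder_cases) auto
  qed
  moreover have "finite (\<Union>i\<in>X. scaled i (V i))"
    using assms(1,2) by (simp add: scaled_def)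
  ultimately show ?thesis
    unfolding is_interface_def by (auto simp: scaled_def)
qed

lemma UN_scaled_boxes:
  "(\<Union>(L, z)\<in>(\<Union>i\<in>X. scaled i (V i)). box L z) = {x. \<exists>i\<in>X. cell i x \<in> V i}"
  by (auto simp: scaled_def box_corner)

lemma max_scale_le:
  assumes "finite I" "I \<noteq> {}" "\<And>L z. (L, z) \<in> I \<Longrightarrow> L \<le> M"
  shows "max_scale I \<le> M"
  unfolding max_scale_def using assms by (intro Max.boundedI) auto

lemma min_scale_ge:
  assumes "finite I" "I \<noteq> {}" "\<And>L z. (L, z) \<in> I \<Longrightarrow> M \<le> L"
  shows "M \<le> min_scale I"
  unfolding min_scale_def using assms by (intro Min.boundedI) auto

lemma cap_empty [simp]: "cap {} = 0"
  by (simp add: cap_def)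

text \<open>From above, a connected set has radius below its cardinality, which
  \<open>card_le_of_cap\<close> bounds polynomially. From below, a cluster of diameter less than 2^s
  would have its closure in a cube of side 2 * 2^s + 1, whose volume is too small for capacity N -
  1.\<close>

lemma diam_cluster_bounds:
  fixes \<phi> :: "('d::finite) config"
  assumes d: "CARD('d) \<ge> 3"
    and A: "\<phi> \<in> A_event h N"
    and N: "N > 1 + 2 * real CARD('d) * real ((2 * 2 ^ s + 1) ^ CARD('d))"
    and m: "m > 0" "2 * N \<le> real m * pot_drop"
  obtains D where "diam (cluster \<phi> h) = enat D" "2 ^ s \<le> D" "real D \<le> 2 * real m * (2 * real m ^ 2 + 1) ^ CARD('d)"
    "\<And>x. x \<in> cluster \<phi> h \<Longrightarrow> l1dist origin x \<le> D"
proof -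
  let ?C = "cluster \<phi> h"
  let ?K = "outer_closure ?C"
  have fin: "finite ?C" and cap: "N - 1 \<le> cap ?K" "cap ?K < N"
    using A by (auto simp: A_event_def)
  have finK: "finite ?K"
    using fin by (rule finite_outer_closure)
  have "N > 1"
    using N by (smt (verit) mult_nonneg_nonneg of_nat_0_le_iff)
  then have ne: "?C \<noteq> {}"
    using cap by (auto simp: outer_closure_def)
  then have o: "origin \<in> ?C"
    by (auto simp: cluster_def)
  obtain x y where xy: "x \<in> ?C" "y \<in> ?C" "diam ?C = enat (l1dist x y)"
    "\<And>u w. u \<in> ?C \<Longrightarrow> w \<in> ?C \<Longrightarrow> l1dist u w \<le> l1dist x y"
    using diam_finite[OF fin ne] by metis
  define D where "D = l1dist x y"
  have rad: "l1dist origin u \<le> D" if "u \<in> ?C" for u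
    unfolding D_def using xy(4)[OF o that] .
  have "D \<le> l1dist origin x + l1dist origin y"
    unfolding D_def using l1dist_triangle[of x y origin] by (simp add: l1dist_commute)
  also have "\<dots> \<le> 2 * card ?C"
    using l1dist_lt_card_cluster[OF fin xy(1)] l1dist_lt_card_cluster[OF fin xy(2)] by simp
  also have "\<dots> \<le> 2 * card ?K"
    using card_mono[OF finK, of ?C] by (auto simp: outer_closure_def)
  finally have "real D \<le> 2 * real (card ?K)"
    by linarith
  also have "\<dots> \<le> 2 * real m * (2 * real m ^ 2 + 1) ^ CARD('d)"
    using card_le_of_cap[OF d finK m(1)] cap(2) m(2) by simp
  finally have up: "real D \<le> \<dots>" .
  have "2 ^ s \<le> D"
  proof (rule ccontr)
    assume small: "\<not> 2 ^ s \<le> D"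
    have near: "l1dist origin z \<le> 2 ^ s" if z: "z \<in> ?K" for z
    proof (cases "z \<in> ?C")
      case True
      then show ?thesis
        using rad[OF True] small by simp
    next
      case False
      then obtain y where "y \<in> ?C" "adj z y"
        using z by (auto simp: outer_closure_def)
      then show ?thesis
        using rad[of y] small l1dist_triangle[of origin z y] by (simp add: adj_def l1dist_commute)
    qed
    have "?K \<subseteq> {x. \<forall>j. x j \<in> {- (2 ^ s)..2 ^ s}}"
    proof (intro subsetI CollectI allI)
      fix z j assume "z \<in> ?K"
      then have "int (l1dist origin z) \<le> int (2 ^ s)"
        by (intro of_nat_mono near)
      then have "\<bar>z j\<bar> \<le> 2 ^ s"
        using order_trans[OF abs_coord_le_l1dist[of z j]] by simp
      then show "z j \<in> {- (2 ^ s)..2 ^ s}"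
        unfolding abs_le_iff by auto
    qed
    then have "card ?K \<le> nat (2 ^ s - - (2 ^ s) + 1) ^ CARD('d)"
      using card_mono[OF finite_cube] card_cube[where 'd = 'd] by metis
    also have "nat (2 ^ s - - (2 ^ s) + 1) = 2 * 2 ^ s + 1"
      by (simp add: nat_eq_iff)
    finally have "real (card ?K) \<le> real ((2 * 2 ^ s + 1) ^ CARD('d))"
      by (rule of_nat_mono)
    then have "2 * real CARD('d) * real (card ?K) \<le> 2 * real CARD('d) * real ((2 * 2 ^ s + 1) ^ CARD('d))"
      by (rule mult_left_mono) simp
    then show False
      using cap_le_card[of ?K] cap(1) N by linarith
  qed
  then show ?thesis
    using that[of D] xy(3) rad up unfolding D_def by blast
qed

section \<open>The interface family at a given capacity\<close>

text \<open>At scale 2^k these are the indices of all cells containing points at distance below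
  2^(k+1) from the origin. The starting set of the recursion is thus the same for every
  configuration and every \<open>k\<close>.\<close>

definition top_cells :: "('d::finite) pt set" where
  "top_cells = {m. \<forall>j. m j \<in> {-2..1}}"

lemma finite_top_cells: "finite (top_cells :: ('d::finite) pt set)"
  unfolding top_cells_def by (rule finite_cube)

lemma card_top_cells: "card (top_cells :: ('d::finite) pt set) = 4 ^ CARD('d)"
  unfolding top_cells_def card_cube by simp

lemma cell_in_top_cells:
  assumes "l1dist origin x < 2 ^ Suc k"
  shows "cell k x \<in> top_cells"
proof -
  have "x j div 2 ^ k \<in> {-2..1}" for j
  proof -
    have "int (l1dist origin x) < int (2 ^ Suc k)"
      using assms by (rule of_nat_less_iff[THEN iffD2])
    then have x: "\<bar>x j\<bar> < 2 * 2 ^ k"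
      using abs_coord_le_l1dist[of x j] by simp
    have p: "(2::int) ^ k > 0"
      by simp
    have "x j div 2 ^ k \<le> (2 * 2 ^ k - 1) div 2 ^ k" "(-2) * 2 ^ k div 2 ^ k \<le> x j div 2 ^ k"
      using x by (intro zdiv_mono1 p; linarith)+
    moreover have "(2 * 2 ^ k - 1) div 2 ^ k = (1::int)"
      using p by (intro int_div_pos_eq[of _ _ _ "2 ^ k - 1"]) auto
    moreover have "(-2) * 2 ^ k div 2 ^ k = (-2::int)"
      by (rule nonzero_mult_div_cancel_right) simp
    ultimately show ?thesis
      unfolding atLeastAtMost_iff by linarith
  qed
  then show ?thesis
    by (simp add: top_cells_def cell_def)
qed

text \<open>Condition (ii) of admissibility requires a diameter of at least the scale; 2^k <= D
  grants it at every scale up to \<open>k\<close>.\<close>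

lemma coarse_graining_cluster:
  fixes \<phi> :: "('d::finite) config"
  assumes adm: "\<forall>L\<ge>1. admissible h L Eb Evb"
    and fin: "finite (cluster \<phi> h)"
    and D: "diam (cluster \<phi> h) = enat D" "2 ^ k \<le> D" and "s \<le> k"
  shows "coarse_graining (cluster \<phi> h) (\<lambda>i. {m. \<phi> \<in> Eb (2 ^ i) (corner i m)})
    (\<lambda>i. {m. \<phi> \<in> Evb (2 ^ i) (corner i m)}) s k"
proof
  have adm2: "admissible h (2 ^ i) Eb Evb" for i
    using adm by simp
  show "{m. \<phi> \<in> Eb (2 ^ i) (corner i m)} \<inter> {m. \<phi> \<in> Evb (2 ^ i) (corner i m)} = {}" for i
    using adm2[of i] corner_in_lattice[of i] unfolding admissible_def by blast
  fix i and m m' :: "'d pt"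
  assume i: "s \<le> i" "i \<le> k"
  have "2 ^ i \<le> D"
    using power_increasing[OF i(2), of "2::nat"] D(2) by linarith
  then have diam: "enat (2 ^ i) \<le> diam (cluster \<phi> h) \<and> diam (cluster \<phi> h) < \<infinity>"
    by (simp add: D(1))
  let ?c = "coarse_cluster \<phi> h (2 ^ i)"
  {
    assume "m \<in> cell i ` cluster \<phi> h" "m' \<notin> cell i ` cluster \<phi> h" "adj m m'"
    then have "corner i m \<in> box_boundary (2 ^ i) ?c"
      unfolding box_boundary_def mem_Collect_eq corner_in_coarse_cluster
      by (intro conjI bexI[of _ "corner i m'"]) (simp_all add: corner_in_coarse_cluster box_adj_corner)
    then show "m \<in> {m. \<phi> \<in> Eb (2 ^ i) (corner i m)} \<union> {m. \<phi> \<in> Evb (2 ^ i) (corner i m)}"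
      using adm2[of i] diam unfolding admissible_def by blast
  next
    assume m: "m \<in> cell i ` cluster \<phi> h" "m' \<in> cell i ` cluster \<phi> h" "adj m m'"
      "m \<in> {m. \<phi> \<in> Eb (2 ^ i) (corner i m)}"
    then have "corner i m \<in> ?c" "corner i m' \<in> ?c" "box_adj (2 ^ i) (corner i m) (corner i m')"
      "\<phi> \<in> Eb (2 ^ i) (corner i m)"
      by (auto simp: corner_in_coarse_cluster box_adj_corner)
    then have "\<phi> \<in> Eb (2 ^ i) (corner i m') \<union> Evb (2 ^ i) (corner i m')"
      using adm2[of i] unfolding admissible_def by blast
    then show "m' \<in> {m. \<phi> \<in> Eb (2 ^ i) (corner i m)} \<union> {m. \<phi> \<in> Evb (2 ^ i) (corner i m)}"
      by blast
  }
qed (use assms in auto)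

text \<open>The statement for a single configuration. The second condition on \<open>t\<close>
  limits the capacity of the bad boxes left at scale 2^s to N / (8 d); \<open>m\<close> and
  \<open>M\<close> bound the number \<open>n\<close> of scales above \<open>s\<close>, through which
  alone the family depends on the configuration.\<close>

lemma interface_exists:
  fixes \<phi> :: "('d::finite) config" and \<rho> t N h :: real
  defines "\<tau> \<equiv> \<lambda>i. t * N * (2 powr - \<rho>) ^ i"
  assumes d: "CARD('d) \<ge> 3"
    and adm: "\<forall>L\<ge>1. admissible h L Eb Evb"
    and A: "\<phi> \<in> A_event h N"
    and t: "t > 0" "2 * real CARD('d) * (\<tau> s * (2 ^ s) ^ CARD('d)) \<le> N / (8 * real CARD('d))"
    and N: "N > 1 + 2 * real CARD('d) * real ((2 * 2 ^ s + 1) ^ CARD('d))" "N \<ge> 4"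
    and m: "m > 0" "2 * N \<le> real m * pot_drop"
    and M: "2 * real m * (2 * real m ^ 2 + 1) ^ CARD('d) \<le> real M"
  shows "\<exists>n\<le>M. \<exists>I\<in>interface_family \<tau> s n top_cells. I \<noteq> {} \<and> is_interface I \<and> occurs Eb Evb I \<phi> \<and>
    enat (max_scale I) \<le> diam (cluster \<phi> h) \<and>
    (\<forall>(L, z)\<in>bad_boxes Eb I \<phi>. L = min_scale I) \<and>
    (cap (\<Union>(L, z)\<in>bad_boxes Evb I \<phi>. box L z) \<ge> N / (4 * real CARD('d)) \<or>
     real (card (bad_boxes Eb I \<phi>)) * real (min_scale I) powr \<rho> \<ge> t * N)"
proof -
  let ?C = "cluster \<phi> h"
  have fin: "finite ?C" and cap: "N - 1 \<le> cap (outer_closure ?C)"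
    using A by (auto simp: A_event_def)
  obtain D where D: "diam ?C = enat D" "2 ^ s \<le> D"
    "real D \<le> 2 * real m * (2 * real m ^ 2 + 1) ^ CARD('d)"
    and rad: "\<And>x. x \<in> ?C \<Longrightarrow> l1dist origin x \<le> D"
    using diam_cluster_bounds[OF d A N(1) m] by metis
  have "(2::nat) ^ s > 0"
    by simp
  then have "D \<ge> 1"
    using D(2) by linarith
  then obtain k where k: "2 ^ k \<le> D" "D < 2 ^ (k + 1)"
    using ex_power_ivl1[of 2 D] by auto
  have "(2::nat) ^ s < 2 ^ (k + 1)"
    using k(2) D(2) by linarith
  then have sk: "s \<le> k"
    using power_less_imp_less_exp[of "2::nat" s "k + 1"] by simp
  \<comment> \<open>A crude bound on \<open>k\<close> suffices, because the number of possible
    starting scales only has to be polynomial in \<open>N\<close>.\<close>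
  have "k < D"
    using less_exp[of k] k(1) by linarith
  then have kM: "k - s \<le> M"
    using D(3) M by linarith
  define b where "b = (\<lambda>i. {m. \<phi> \<in> Eb (2 ^ i) (corner i m)})"
  define v where "v = (\<lambda>i. {m. \<phi> \<in> Evb (2 ^ i) (corner i m)})"
  interpret coarse_graining ?C b v s k
    unfolding b_def v_def using adm fin D(1) k(1) sk by (rule coarse_graining_cluster)
  have top: "cell k ` ?C \<subseteq> top_cells"
    using rad k(2) by (force intro: cell_in_top_cells)
  have bs: "\<phi> \<in> Eb (2 ^ i) (corner i m) \<longleftrightarrow> m \<in> b i" "\<phi> \<in> Evb (2 ^ i) (corner i m) \<longleftrightarrow> m \<in> v i" for i m
    by (auto simp: b_def v_def)
  have q: "(2 powr - \<rho>) ^ i * (2 ^ i) powr \<rho> = 1" for i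
  proof -
    have "(2 powr - \<rho>) ^ i * (2 ^ i) powr \<rho> = 2 powr (- \<rho> * real i) * 2 powr (real i * \<rho>)"
      by (simp add: powr_powr powr_power flip: powr_realpow)
    also have "\<dots> = 1"
      by (simp flip: powr_add)
    finally show ?thesis .
  qed
  have tau: "real (card (Bs i)) \<le> \<tau> i" if "\<not> real (card (Bs i)) * (2 ^ i) powr \<rho> \<ge> t * N" for i
  proof -
    have "(real (card (Bs i)) * (2 ^ i) powr \<rho>) * (2 powr - \<rho>) ^ i \<le> t * N * (2 powr - \<rho>) ^ i"
      using that by (intro mult_right_mono) auto
    moreover have "(real (card (Bs i)) * (2 ^ i) powr \<rho>) * (2 powr - \<rho>) ^ i = real (card (Bs i))"
      using q[of i] by (metis mult.assoc mult.commute mult.right_neutral)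
    ultimately show ?thesis
      by (simp add: \<tau>_def)
  qed
  have scale_le: "2 ^ i \<le> D" if "i \<le> k" for i
    using power_increasing[OF that, of "2::nat"] k(1) by linarith
  show ?thesis
  proof (cases "\<exists>i\<in>{s..k}. real (card (Bs i)) * (2 ^ i) powr \<rho> \<ge> t * N")
    case True
    define X where "X = {i\<in>{s..k}. real (card (Bs i)) * (2 ^ i) powr \<rho> \<ge> t * N}"
    have X: "finite X" "X \<noteq> {}"
      using True by (auto simp: X_def)
    define i where "i = Max X"
    have "i \<in> X"
      unfolding i_def using X by (rule Max_in)
    then have i: "s \<le> i" "i \<le> k" "real (card (Bs i)) * (2 ^ i) powr \<rho> \<ge> t * N"
      by (auto simp: X_def)
    have above: "real (card (Bs l)) \<le> \<tau> l" if "i < l" "l \<le> k" for l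
    proof (rule tau, rule notI)
      assume "t * N \<le> real (card (Bs l)) * (2 ^ l) powr \<rho>"
      then have "l \<in> X"
        using that i by (simp add: X_def)
      then have "l \<le> i"
        unfolding i_def using X by simp
      then show False
        using that by simp
    qed
    define I where "I = scaled i (Bs i)"
    \<comment> \<open>Only the bad boxes of scale \<open>i\<close> are kept. The subdivided sets
      follow \<open>Bs\<close> strictly above \<open>i\<close>, where maximality of \<open>i\<close>
      provides the bound \<tau>, and are empty from \<open>i\<close> downwards.\<close>
    define V' where "V' = (\<lambda>l. if l = i then Bs i else {})"
    define B' where "B' = (\<lambda>l. if i < l then Bs l else {})"
    have tau0: "\<tau> l \<ge> 0" for l
      using t(1) N(2) by (simp add: \<tau>_def)
    have "(\<Union>l\<in>{s..s + (k - s)}. scaled l (V' l)) \<in> interface_family \<tau> s (k - s) top_cells"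
    proof (rule interface_familyI)
      fix l assume l: "s \<le> l" "l < s + (k - s)"
      show "V' l \<subseteq> children (B' (Suc l))" "B' l \<subseteq> children (B' (Suc l))"
        using Bs_children[of l] l sk by (auto simp: V'_def B'_def)
    next
      show "real (card (B' l)) \<le> \<tau> l" if "s < l" "l \<le> s + (k - s)" for l
        using above[of l] tau0[of l] that sk by (auto simp: B'_def)
      show "V' (s + (k - s)) \<subseteq> top_cells" "B' (s + (k - s)) \<subseteq> top_cells"
        using sk Bs_subset[of k] top by (auto simp: V'_def B'_def)
    qed
    moreover have "(\<Union>l\<in>{s..s + (k - s)}. scaled l (V' l)) = I"
      using i(1,2) by (auto simp: V'_def I_def scaled_def split: if_splits)
    ultimately have mem: "I \<in> interface_family \<tau> s (k - s) top_cells"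
      by simp
    have "0 < t * N"
      using t N by simp
    then have "Bs i \<noteq> {}"
      using i(3) by auto
    then have ne: "I \<noteq> {}"
      by (simp add: I_def scaled_def)
    have "fst ` I = {2 ^ i}"
      using \<open>Bs i \<noteq> {}\<close> by (auto simp: I_def scaled_def image_image)
    then have sc: "min_scale I = 2 ^ i" "max_scale I = 2 ^ i"
      by (simp_all add: min_scale_def max_scale_def)
    have int: "is_interface I"
      using is_interface_UN_scaled[of "{i}" Bs] finite_Bs by (simp add: I_def)
    have bad: "bad_boxes Eb I \<phi> = I"
      using Bs_subset[OF i(2)] by (auto simp: bad_boxes_def I_def scaled_def bs)
    have occ: "occurs Eb Evb I \<phi>"
      using Bs_subset[OF i(2)] by (auto simp: occurs_def I_def scaled_def bs)
    have "\<forall>(L, z)\<in>bad_boxes Eb I \<phi>. L = min_scale I"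
      unfolding bad sc by (auto simp: I_def scaled_def)
    moreover have "real (card (bad_boxes Eb I \<phi>)) * real (min_scale I) powr \<rho> \<ge> t * N"
      unfolding bad sc using i(3) by (simp add: I_def card_scaled)
    moreover have "enat (max_scale I) \<le> diam ?C"
      unfolding sc D(1) using scale_le[OF i(2)] by simp
    ultimately show ?thesis
      using kM mem ne int occ by blast
  next
    case False
    define I where "I = (\<Union>i\<in>{s..k}. scaled i (Vs i))"
    have "(\<Union>i\<in>{s..s + (k - s)}. scaled i (Vs i)) \<in> interface_family \<tau> s (k - s) top_cells"
    proof (rule interface_familyI[where B = Bs])
      show "real (card (Bs l)) \<le> \<tau> l" if "s < l" "l \<le> s + (k - s)" for l
        using False that sk by (intro tau) auto
      show "Vs (s + (k - s)) \<subseteq> top_cells" "Bs (s + (k - s)) \<subseteq> top_cells"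
        using sk Bs_subset[of k] Vs_subset[of k] top by auto
    qed (use Vs_children Bs_children in auto)
    then have mem: "I \<in> interface_family \<tau> s (k - s) top_cells"
      using sk by (simp add: I_def)
    have int: "is_interface I"
      unfolding I_def
    proof (rule is_interface_UN_scaled)
      fix i l x assume "i \<in> {s..k}" "l \<in> {s..k}" "i < l" "cell i x \<in> Vs i" "cell l x \<in> Vs l"
      then show False
        using disjoint[of l] unfolding cell_in_Vs_iff by auto
    qed (auto simp: finite_Vs)
    have occ: "occurs Eb Evb I \<phi>" and badv: "bad_boxes Evb I \<phi> = I"
      using Vs_subset by (fastforce simp: occurs_def bad_boxes_def I_def scaled_def bs)+
    have badb: "bad_boxes Eb I \<phi> = {}"
      using Vs_subset disjoint by (fastforce simp: bad_boxes_def I_def scaled_def bs)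
    have boxes: "(\<Union>(L, z)\<in>bad_boxes Evb I \<phi>. box L z) = VS"
      unfolding badv unfolding I_def UN_scaled_boxes VS_def ..
    let ?d = "real CARD('d)"
    have "cap BS \<le> 2 * ?d * (real (card (Bs s)) * (2 ^ s) ^ CARD('d))"
      by (rule cap_BS_le)
    also have "\<dots> \<le> 2 * ?d * (\<tau> s * (2 ^ s) ^ CARD('d))"
      using False sk by (intro mult_left_mono mult_right_mono tau) auto
    also have "\<dots> \<le> N / (8 * ?d)"
      by (rule t(2))
    finally have "cap BS \<le> N / (8 * ?d)" .
    moreover have "(N - 1) / (2 * ?d) \<le> cap (outer_closure ?C) / (2 * ?d)"
      using cap by (intro divide_right_mono) auto
    moreover have "cap (outer_closure ?C) / (2 * ?d) \<le> cap (VS \<union> BS)"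
      by (rule cap_VS_BS[OF d finite_outer_closure[OF fin]])
    moreover have "cap (VS \<union> BS) \<le> cap VS + cap BS"
      by (rule cap_Un_le[OF finite_VS finite_BS])
    \<comment> \<open>After clearing denominators this reads 3 N <= 4 (N - 1), which is N >=
      4.\<close>
    moreover have "N / (4 * ?d) + N / (8 * ?d) \<le> (N - 1) / (2 * ?d)"
      using N(2) by (simp add: field_simps)
    ultimately have capV: "N / (4 * ?d) \<le> cap VS"
      by linarith
    moreover have "N / (4 * ?d) > 0"
      using N(2) by simp
    ultimately have "VS \<noteq> {}"
      by auto
    then have ne: "I \<noteq> {}"
      by (auto simp: VS_def I_def scaled_def)
    have "max_scale I \<le> D"
      using int ne scale_le by (intro max_scale_le) (auto simp: is_interface_def I_def scaled_def)
    then have "enat (max_scale I) \<le> diam ?C"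
      by (simp add: D(1))
    moreover have "\<forall>(L, z)\<in>bad_boxes Eb I \<phi>. L = min_scale I"
      unfolding badb by simp
    moreover have "N / (4 * ?d) \<le> cap (\<Union>(L, z)\<in>bad_boxes Evb I \<phi>. box L z)"
      unfolding boxes by (rule capV)
    ultimately show ?thesis
      using kM mem ne int occ by blast
  qed
qed

section \<open>Elementary estimates and the choice of constants\<close>

lemma geometric_tail_le:
  fixes q :: real
  assumes "0 < q" "q < 1"
  shows "(\<Sum>i=1..n. q ^ (s + i)) \<le> q ^ s / (1 - q)"
proof -
  have "(\<Sum>i=1..n. q ^ (s + i)) \<le> (\<Sum>i\<le>n. q ^ (s + i))"
    using assms by (intro sum_mono2) auto
  also have "\<dots> = q ^ s * (\<Sum>i\<le>n. q ^ i)"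
    by (simp add: power_add sum_distrib_left)
  also have "(\<Sum>i\<le>n. q ^ i) \<le> 1 / (1 - q)"
    using assms by (simp add: sum_gp0 divide_right_mono)
  finally show ?thesis
    using assms by simp
qed

lemma exp_dominates_power:
  fixes a c :: real
  assumes "a > 0"
  shows "eventually (\<lambda>x. c * x ^ n \<le> exp (a * x)) at_top"
proof -
  have "((\<lambda>y. y ^ n / exp y) \<longlongrightarrow> (0::real)) at_top"
    by (rule tendsto_power_div_exp_0)
  moreover have "filterlim (\<lambda>x. a * x) at_top at_top"
    using assms by (intro filterlim_tendsto_pos_mult_at_top[OF tendsto_const]) (auto simp: filterlim_ident)
  ultimately have "((\<lambda>x. (a * x) ^ n / exp (a * x)) \<longlongrightarrow> 0) at_top"
    by (rule filterlim_compose)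
  then have "((\<lambda>x. c / a ^ n * ((a * x) ^ n / exp (a * x))) \<longlongrightarrow> c / a ^ n * 0) at_top"
    by (rule tendsto_mult_left)
  then have "eventually (\<lambda>x. c / a ^ n * ((a * x) ^ n / exp (a * x)) < 1) at_top"
    by (rule order_tendstoD(2)) simp
  then show ?thesis
  proof eventually_elim
    case (elim x)
    then show ?case
      using assms by (simp add: field_simps)
  qed
qed


theorem theorem3p2:
  fixes \<rho> \<delta> :: real
  assumes "CARD('d::finite) \<ge> 3" and "\<rho> > 0" and "\<delta> > 0"
  shows "\<exists>t L0 N0 :: real. 0 < t \<and> t < 1 \<and> 0 < L0 \<and> 0 < N0 \<and>
    (\<forall>(h::real) (Eb :: nat \<Rightarrow> 'd pt \<Rightarrow> 'd config set) (Evb :: nat \<Rightarrow> 'd pt \<Rightarrow> 'd config set).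
      (\<forall>L\<ge>1. admissible h L Eb Evb) \<longrightarrow>
      (\<forall>N::real. N \<ge> N0 \<longrightarrow>
        (\<exists>IN :: (nat \<times> 'd pt) set set.
           finite IN \<and> (\<forall>I\<in>IN. is_interface I) \<and>
           real (card IN) \<le> exp (\<delta> * t * N) \<and>
           (\<forall>I\<in>IN. L0 \<le> real (min_scale I) \<and> real (card I) \<le> \<delta> * t * N) \<and>
           (\<forall>\<phi>\<in>A_event h N.
              \<exists>I\<in>IN. occurs Eb Evb I \<phi> \<and>
                enat (max_scale I) \<le> diam (cluster \<phi> h) \<and>
                (\<forall>(L, z)\<in>bad_boxes Eb I \<phi>. L = min_scale I) \<and>
                (cap (\<Union>(L, z)\<in>bad_boxes Evb I \<phi>. box L z) \<ge> N / (4 * real CARD('d)) \<or>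
                 real (card (bad_boxes Eb I \<phi>)) * real (min_scale I) powr \<rho> \<ge> t * N)))))"
proof -
  let ?n = "CARD('d)"
  let ?d = "real CARD('d)"
  define q where "q = 2 powr - \<rho>"
  have q: "0 < q" "q < 1"
    using assms(2) powr_less_mono[of "-\<rho>" 0 2] by (auto simp: q_def)
  \<comment> \<open>The geometric series from scale \<open>s\<close> on, multiplied by the 2^d
    children per cell, then amounts to at most a quarter of the budget \<delta> t N.\<close>
  obtain s where s: "q ^ s < \<delta> * (1 - q) / (4 * 2 ^ ?n)"
    using real_arch_pow_inv[of "\<delta> * (1 - q) / (4 * 2 ^ ?n)" q] q assms(3) by auto
  \<comment> \<open>Chosen so that the volume bound 2 d t N q^s 2^(s d) for the capacity of the last
    bad boxes equals q^s N / (8 d).\<close>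
  define t where "t = 1 / (16 * ?d ^ 2 * (2 ^ s) ^ ?n)"
  have d1: "?d \<ge> 1"
    using assms(1) by simp
  have p1: "((2::real) ^ s) ^ ?n \<ge> 1"
    by (intro one_le_power) simp
  have big: "16 * ?d ^ 2 * (2 ^ s) ^ ?n > 1"
  proof -
    have "1 * 1 \<le> ?d ^ 2 * (2 ^ s) ^ ?n"
      using d1 p1 by (intro mult_mono one_le_power) auto
    then show ?thesis
      by simp
  qed
  have t: "0 < t" "t < 1"
    using big by (simp_all add: t_def)
  \<comment> \<open>\<open>m N\<close> is the smallest radius parameter for which
    \<open>card_le_of_cap\<close> covers capacities up to \<open>N\<close>, and \<open>M N\<close>
    is the resulting bound on the diameter. Both are polynomial in \<open>N\<close>, with
    \<open>m N\<close> at most \<open>c * N\<close>.\<close>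
  define m where "m N = nat \<lceil>2 * N / pot_drop\<rceil>" for N :: real
  define M where "M N = 2 * m N * (2 * m N ^ 2 + 1) ^ ?n" for N
  define c where "c = 2 / pot_drop + 1"
  \<comment> \<open>Half of the exponent \<delta> t N is reserved for the number of starting scales
    and for the choices among the top cells.\<close>
  have "eventually (\<lambda>N. (4 ^ 4 ^ ?n * (3 * c) ^ (2 * ?n + 1)) * N ^ (2 * ?n + 1) \<le> exp (\<delta> * t / 2 * N)) at_top"
    by (rule exp_dominates_power) (use assms t in auto)
  moreover have "eventually (\<lambda>N. N \<ge> max 4 (max (2 + 2 * ?d * real ((2 * 2 ^ s + 1) ^ ?n)) (4 ^ ?n * 2 / (\<delta> * t)))) at_top"
    by (rule eventually_ge_at_top)
  ultimately have "eventually (\<lambda>N. (4 ^ 4 ^ ?n * (3 * c) ^ (2 * ?n + 1)) * N ^ (2 * ?n + 1) \<le> exp (\<delta> * t / 2 * N) \<and>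
      N \<ge> max 4 (max (2 + 2 * ?d * real ((2 * 2 ^ s + 1) ^ ?n)) (4 ^ ?n * 2 / (\<delta> * t)))) at_top"
    by (rule eventually_conj)
  then obtain N1 where N1: "\<And>N. N \<ge> N1 \<Longrightarrow>
      (4 ^ 4 ^ ?n * (3 * c) ^ (2 * ?n + 1)) * N ^ (2 * ?n + 1) \<le> exp (\<delta> * t / 2 * N) \<and>
      N \<ge> max 4 (max (2 + 2 * ?d * real ((2 * 2 ^ s + 1) ^ ?n)) (4 ^ ?n * 2 / (\<delta> * t)))"
    unfolding eventually_at_top_linorder by blast
  have main: "\<exists>IN :: (nat \<times> 'd pt) set set.
      finite IN \<and> (\<forall>I\<in>IN. is_interface I) \<and>
      real (card IN) \<le> exp (\<delta> * t * N) \<and>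
      (\<forall>I\<in>IN. 2 ^ s \<le> real (min_scale I) \<and> real (card I) \<le> \<delta> * t * N) \<and>
      (\<forall>\<phi>\<in>A_event h N.
        \<exists>I\<in>IN. occurs Eb Evb I \<phi> \<and>
          enat (max_scale I) \<le> diam (cluster \<phi> h) \<and>
          (\<forall>(L, z)\<in>bad_boxes Eb I \<phi>. L = min_scale I) \<and>
          (cap (\<Union>(L, z)\<in>bad_boxes Evb I \<phi>. box L z) \<ge> N / (4 * ?d) \<or>
           real (card (bad_boxes Eb I \<phi>)) * real (min_scale I) powr \<rho> \<ge> t * N))"
    if adm: "\<forall>L\<ge>1. admissible h L Eb Evb" and N: "N \<ge> N1"
    for h N and Eb Evb :: "nat \<Rightarrow> 'd pt \<Rightarrow> 'd config set"
  proof -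
    have N4: "N \<ge> 4" and Nbig: "N > 1 + 2 * ?d * real ((2 * 2 ^ s + 1) ^ ?n)" and "N \<ge> 4 ^ ?n * 2 / (\<delta> * t)"
      using N1[OF N] by auto
    then have top: "4 ^ ?n \<le> \<delta> * t * N / 2"
      using assms(3) t by (simp add: field_simps)
    define \<tau> where "\<tau> = (\<lambda>i. t * N * q ^ i)"
    \<comment> \<open>A quarter of the budget. One family costs 4 powr y <= exp (2 y) apart from the
      top cells, and the factor set aside for scales and top cells is again exp (2 y), so the total
      is exp (4 y).\<close>
    define y where "y = \<delta> * t * N / 4"
    \<comment> \<open>Members of \<open>interface_family\<close> may be empty or contain overlapping
      boxes. The filter restores disjointness and makes \<open>min_scale\<close> and
      \<open>max_scale\<close> meaningful.\<close>
    define IN where "IN = {I \<in> (\<Union>n\<le>M N. interface_family \<tau> s n (top_cells :: 'd pt set)). I \<noteq> {} \<and> is_interface I}"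
    have m0: "m N > 0" "2 * N \<le> real (m N) * pot_drop"
    proof -
      have "0 < 2 * N / pot_drop"
        using N4 pot_drop_pos by simp
      then show "m N > 0"
        by (simp add: m_def)
      have "2 * N / pot_drop \<le> real (m N)"
        unfolding m_def by (rule real_nat_ceiling_ge)
      then show "2 * N \<le> real (m N) * pot_drop"
        using pot_drop_pos by (simp add: pos_divide_le_eq)
    qed
    have tail: "2 ^ ?n * (\<Sum>i=1..n. \<tau> (s + i)) \<le> y" for n
    proof -
      have "(\<Sum>i=1..n. q ^ (s + i)) \<le> \<delta> / (4 * 2 ^ ?n)"
        using geometric_tail_le[OF q, of s n] divide_right_mono[OF less_imp_le[OF s], of "1 - q"] q by simp
      then have "2 ^ ?n * (t * N) * (\<Sum>i=1..n. q ^ (s + i)) \<le> 2 ^ ?n * (t * N) * (\<delta> / (4 * 2 ^ ?n))"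
        using t N4 by (intro mult_left_mono) auto
      also have "\<dots> = y"
        by (simp add: y_def)
      finally show ?thesis
        by (simp add: \<tau>_def sum_distrib_left mult_ac)
    qed
    have fam: "finite (interface_family \<tau> s n (top_cells :: 'd pt set))"
      "real (card (interface_family \<tau> s n (top_cells :: 'd pt set))) \<le> 4 ^ 4 ^ ?n * exp (2 * y)"
      "\<And>I :: (nat \<times> 'd pt) set. I \<in> interface_family \<tau> s n top_cells \<Longrightarrow> finite I \<and> real (card I) \<le> 4 ^ ?n + y \<and> (\<forall>(L, z)\<in>I. 2 ^ s \<le> L)"
      for n
    proof -
      note P = interface_family_bounds[OF finite_top_cells, of \<tau> s n, where 'd = 'd, unfolded card_top_cells]
      show "finite (interface_family \<tau> s n (top_cells :: 'd pt set))"
        using P by blast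
      show "finite I \<and> real (card I) \<le> 4 ^ ?n + y \<and> (\<forall>(L, z)\<in>I. 2 ^ s \<le> L)"
        if "I \<in> interface_family \<tau> s n (top_cells :: 'd pt set)" for I
        using P that tail[of n] by fastforce
      have "real (card (interface_family \<tau> s n (top_cells :: 'd pt set))) \<le> 4 powr (real (4 ^ ?n) + 2 ^ ?n * (\<Sum>i=1..n. \<tau> (s + i)))"
        using P by blast
      also have "\<dots> \<le> 4 powr (real (4 ^ ?n) + y)"
        using tail[of n] by (intro powr_mono) auto
      also have "\<dots> = 4 ^ 4 ^ ?n * 4 powr y"
        unfolding powr_add by (subst powr_realpow) auto
      also have "4 powr y = exp (y * (2 * ln 2))"
        using ln_realpow[of 2 2] by (simp add: powr_def)
      also have "\<dots> \<le> exp (2 * y)"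
        using ln_le_minus_one[of "2::real"] assms(3) t N4
        by (simp add: y_def mult_left_le)
      finally show "real (card (interface_family \<tau> s n (top_cells :: 'd pt set))) \<le> 4 ^ 4 ^ ?n * exp (2 * y)"
        by simp
    qed
    have count: "real (M N + 1) * 4 ^ 4 ^ ?n \<le> exp (2 * y)"
    proof -
      have m1: "real (m N) \<le> c * N"
      proof -
        have "real (m N) \<le> 2 * N / pot_drop + 1"
          unfolding m_def using N4 pot_drop_pos by simp
        also have "\<dots> \<le> c * N"
          using N4 by (simp add: c_def algebra_simps)
        finally show ?thesis .
      qed
      have "2 * m N ^ 2 + 1 \<le> (3 * m N) ^ 2"
        using m0(1) by (simp add: power_mult_distrib Suc_le_eq)
      then have "(2 * m N ^ 2 + 1) ^ ?n \<le> ((3 * m N) ^ 2) ^ ?n"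
        by (rule power_mono) simp
      moreover have "1 \<le> ((3 * m N) ^ 2) ^ ?n"
        using m0(1) by (intro one_le_power) simp
      \<comment> \<open>The additive 1 is enlarged to m (3 m)^(2 d), so that both terms merge into
        the single power (3 m)^(2 d + 1).\<close>
      ultimately have "M N + 1 \<le> 2 * m N * ((3 * m N) ^ 2) ^ ?n + m N * ((3 * m N) ^ 2) ^ ?n"
        unfolding M_def using m0(1) by (intro add_mono mult_left_mono) (auto simp: Suc_le_eq)
      also have "\<dots> = (3 * m N) ^ (2 * ?n + 1)"
        unfolding power_add power_mult by simp
      finally have "real (M N + 1) \<le> real ((3 * m N) ^ (2 * ?n + 1))"
        by (rule of_nat_mono)
      also have "\<dots> = (3 * real (m N)) ^ (2 * ?n + 1)"
        by simp
      also have "\<dots> \<le> (3 * (c * N)) ^ (2 * ?n + 1)"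
        using m1 by (intro power_mono mult_left_mono) auto
      also have "\<dots> = (3 * c) ^ (2 * ?n + 1) * N ^ (2 * ?n + 1)"
        unfolding power_mult_distrib[symmetric] by (simp add: mult.assoc)
      finally have "real (M N + 1) * 4 ^ 4 ^ ?n \<le> (3 * c) ^ (2 * ?n + 1) * N ^ (2 * ?n + 1) * 4 ^ 4 ^ ?n"
        by (rule mult_right_mono) simp
      also have "\<dots> \<le> exp (\<delta> * t / 2 * N)"
        using N1[OF N] by (simp only: mult_ac)
      finally show ?thesis
        by (simp add: y_def mult_ac)
    qed
    have finU: "finite (\<Union>n\<le>M N. interface_family \<tau> s n (top_cells :: 'd pt set))"
      using fam(1) by blast
    have "real (card IN) \<le> real (card (\<Union>n\<le>M N. interface_family \<tau> s n (top_cells :: 'd pt set)))"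
      unfolding IN_def using finU by (intro of_nat_mono card_mono) auto
    also have "\<dots> \<le> real (\<Sum>n\<le>M N. card (interface_family \<tau> s n (top_cells :: 'd pt set)))"
      by (intro of_nat_mono card_UN_le) simp
    also have "\<dots> = (\<Sum>n\<le>M N. real (card (interface_family \<tau> s n (top_cells :: 'd pt set))))"
      by simp
    also have "\<dots> \<le> (\<Sum>n\<le>M N. 4 ^ 4 ^ ?n * exp (2 * y))"
      by (intro sum_mono fam)
    also have "\<dots> = (real (M N + 1) * 4 ^ 4 ^ ?n) * exp (2 * y)"
      by simp
    also have "\<dots> \<le> exp (2 * y) * exp (2 * y)"
      using count by (rule mult_right_mono) simp
    also have "\<dots> = exp (\<delta> * t * N)"
      by (simp add: y_def flip: exp_add)
    finally have card: "real (card IN) \<le> exp (\<delta> * t * N)" .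
    have each: "2 ^ s \<le> real (min_scale I) \<and> real (card I) \<le> \<delta> * t * N" if I: "I \<in> IN" for I
    proof -
      obtain n where n: "I \<in> interface_family \<tau> s n (top_cells :: 'd pt set)" and ne: "I \<noteq> {}"
        using I by (auto simp: IN_def)
      note F = fam(3)[OF n]
      have "2 ^ s \<le> min_scale I"
        using F ne by (intro min_scale_ge) auto
      then have "real (2 ^ s) \<le> real (min_scale I)"
        by (rule of_nat_mono)
      moreover have "0 \<le> \<delta> * t * N"
        using assms(3) t N4 by simp
      then have "real (card I) \<le> \<delta> * t * N"
        using F top unfolding y_def by linarith
      ultimately show ?thesis
        by simp
    qed
    have "\<exists>I\<in>IN. occurs Eb Evb I \<phi> \<and>
          enat (max_scale I) \<le> diam (cluster \<phi> h) \<and>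
          (\<forall>(L, z)\<in>bad_boxes Eb I \<phi>. L = min_scale I) \<and>
          (cap (\<Union>(L, z)\<in>bad_boxes Evb I \<phi>. box L z) \<ge> N / (4 * ?d) \<or>
           real (card (bad_boxes Eb I \<phi>)) * real (min_scale I) powr \<rho> \<ge> t * N)"
      if A: "\<phi> \<in> A_event h N" for \<phi>
    proof -
      have "2 * ?d * (t * N * q ^ s * (2 ^ s) ^ ?n) = q ^ s * (N / (8 * ?d))"
        using d1 by (simp add: t_def power2_eq_square)
      also have "\<dots> \<le> N / (8 * ?d)"
        using q N4 by (intro mult_left_le_one_le power_le_one) auto
      finally have small: "2 * ?d * (t * N * q ^ s * (2 ^ s) ^ ?n) \<le> N / (8 * ?d)" .
      have MN: "2 * real (m N) * (2 * real (m N) ^ 2 + 1) ^ ?n \<le> real (M N)"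
        by (simp add: M_def add_ac)
      obtain n I where "n \<le> M N" "I \<in> interface_family \<tau> s n top_cells" "I \<noteq> {}" "is_interface I"
        and I: "occurs Eb Evb I \<phi> \<and>
          enat (max_scale I) \<le> diam (cluster \<phi> h) \<and>
          (\<forall>(L, z)\<in>bad_boxes Eb I \<phi>. L = min_scale I) \<and>
          (cap (\<Union>(L, z)\<in>bad_boxes Evb I \<phi>. box L z) \<ge> N / (4 * ?d) \<or>
           real (card (bad_boxes Eb I \<phi>)) * real (min_scale I) powr \<rho> \<ge> t * N)"
        using interface_exists[OF assms(1) adm A t(1) small[unfolded q_def] Nbig N4 m0 MN]
        unfolding \<tau>_def q_def by blast
      then have "I \<in> IN"
        by (auto simp: IN_def)
      then show ?thesis
        using I by blast
    qed
    moreover have "finite IN" "\<forall>I\<in>IN. is_interface I"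
      using finU by (auto simp: IN_def)
    ultimately show ?thesis
      using card each by blast
  qed
  show ?thesis
  proof (rule exI[of _ t], rule exI[of _ "2 ^ s"], rule exI[of _ "max N1 1"], intro conjI allI impI)
    fix h N and Eb Evb :: "nat \<Rightarrow> 'd pt \<Rightarrow> 'd config set"
    assume adm: "\<forall>L\<ge>1. admissible h L Eb Evb" and N: "N \<ge> max N1 1"
    have "N \<ge> N1"
      using N by simp
    show "\<exists>IN :: (nat \<times> 'd pt) set set.
      finite IN \<and> (\<forall>I\<in>IN. is_interface I) \<and>
      real (card IN) \<le> exp (\<delta> * t * N) \<and>
      (\<forall>I\<in>IN. 2 ^ s \<le> real (min_scale I) \<and> real (card I) \<le> \<delta> * t * N) \<and>
      (\<forall>\<phi>\<in>A_event h N.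
        \<exists>I\<in>IN. occurs Eb Evb I \<phi> \<and>
          enat (max_scale I) \<le> diam (cluster \<phi> h) \<and>
          (\<forall>(L, z)\<in>bad_boxes Eb I \<phi>. L = min_scale I) \<and>
          (cap (\<Union>(L, z)\<in>bad_boxes Evb I \<phi>. box L z) \<ge> N / (4 * ?d) \<or>
           real (card (bad_boxes Eb I \<phi>)) * real (min_scale I) powr \<rho> \<ge> t * N))"
      by (rule main[OF adm \<open>N \<ge> N1\<close>])
  qed (use t in auto)
qed

end
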